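(* Let $\Omega\subset\mathbb{R}^2$ be a bounded Lipschitz domain, $\epsilon\in(0,1]$, $\bm f\in (L^2(\Omega))^3$, let $\bm u=(p,n,\psi)\in (H^1(\Omega))^3$ be a weak solution (with Dirichlet boundary conditions) of the steady-state Poisson-Nernst-Planck system, i.e. $\langle \bm F(\bm u),\bm v\rangle=0$ for all $\bm v\in (H_0^1(\Omega))^3$, let $\bm u_h=(p_h,n_h,\psi_h)$ be its piecewise linear finite element approximation, and let $\bm e=\bm u-\bm u_h=(e_1,e_2,e_3)\in (H_0^1(\Omega))^3$. Assume $p,n\in L^\infty(\Omega)$, $\psi\in W^{1,\infty}(\Omega)$, and $$\|\nabla\psi\|_{L^{\infty}(\Omega)}+\sqrt{2}\,C_p\,\epsilon^{-1}\max\{\|p\|_{L^{\infty}(\Omega)},\|n\|_{L^{\infty}(\Omega)}\}<\frac{\sqrt{2}}{1+C_p^2}.$$ Let $C_1,C_2>0$ be the constants, independent of $\bm\phi$, $\bm R$ and $\epsilon$, in the two-sided estimate $$\epsilon\, C_1\|\bm R\|_{-\epsilon,\Omega}\le\|\bm\phi\|_{\epsilon,\Omega}\le C_2\|\bm R\|_{-\epsilon,\Omega}$$ for $\bm\phi\in (H_0^1(\Omega))^3$ and $\bm R=\bm{DF}(\bm u)\bm\phi$, taken with $\bm\phi=\bm e$. If the error $\bm e$ is small enough (that is, there is a threshold $\delta>0$, independent of $\bm u_h$, such that the following holds whenever $\max_{i=1,2}\|e_i\|_{L^\infty(\Omega)}\le\delta$), then $$\frac{2\epsilon\, C_1C_2}{C_1+2C_2}\,\|\bm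 F(\bm u_h)\|_{-\epsilon,\Omega}\le\|\bm e\|_{\epsilon,\Omega}\le 2C_2\,\|\bm F(\bm u_h)\|_{-\epsilon,\Omega}.$$
   Context: The steady-state Poisson-Nernst-Planck system is $-\Delta p-\nabla\cdot(p\nabla\psi)=f_1$, $-\Delta n+\nabla\cdot(n\nabla\psi)=f_2$, $-\epsilon\Delta\psi=p-n+f_3$ in $\Omega$, with Dirichlet boundary conditions. The nonlinear operator $\bm F$ is defined, for $\bm u=(p,n,\psi)$ and $\bm v=(v_1,v_2,v_3)\in (H_0^1(\Omega))^3$, by $$\langle \bm F(\bm u),\bm v\rangle=\int_\Omega\big(\nabla p\cdot\nabla v_1+p\nabla\psi\cdot\nabla v_1+\nabla n\cdot\nabla v_2-n\nabla\psi\cdot\nabla v_2+\epsilon\nabla\psi\cdot\nabla v_3-pv_3+nv_3-f_1v_1-f_2v_2-f_3v_3\big)\,d\bm x .$$ $\bm{DF}(\bm u)$ is its Gâteaux derivative at $\bm u$: $$\langle \bm{DF}(\bm u)\bm\phi,\bm v\rangle=\int_\Omega\big(\nabla\phi_1\cdot\nabla v_1+p\nabla\phi_3\cdot\nabla v_1+\phi_1\nabla\psi\cdot\nabla v_1+\nabla\phi_2\cdot\nabla v_2-n\nabla\phi_3\cdot\nabla v_2-\phi_2\nabla\psi\cdot\nabla v_2+\epsilon\nabla\phi_3\cdot\nabla v_3-\phi_1v_3+\phi_2v_3\big)\,d\bm x .$$ The constant $C_p$ depends only on $\Omega$: it is the Poincaré constant, $\|v\|_{L^2(\Omega)}\le C_p\|\nabla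 v\|_{L^2(\Omega)}$ for all $v\in H_0^1(\Omega)$. Discretization: $\mathcal T_h$ is a quasi-uniform triangulation of $\Omega$ with mesh size $0<h<1$; $V_h=\{v\in H_0^1(\Omega): v|_T\in\mathcal P_1(T)\ \forall T\in\mathcal T_h\}$; $p_h,n_h,\psi_h\in H^1(\Omega)$ are piecewise $\mathcal P_1$ on $\mathcal T_h$ with the same boundary values on $\partial\Omega$ as $p,n,\psi$ respectively, and $\langle\bm F(\bm u_h),\bm v_h\rangle=0$ for all $\bm v_h\in (V_h)^3$. Norms: $\|\phi\|_{\epsilon,\Omega}=(\|\phi\|_{L^2(\Omega)}^2+\epsilon\|\nabla\phi\|_{L^2(\Omega)}^2)^{1/2}$ for scalar $\phi\in H^1(\Omega)$; for a triple, $\|\bm\phi\|_{\epsilon,\Omega}=(\sum_{i=1}^3\|\phi_i\|_{\epsilon,\Omega}^2)^{1/2}$; and for a functional $\bm G$ in the dual of $(H_0^1(\Omega))^3$, $\|\bm G\|_{-\epsilon,\Omega}=\sup_{\bm v\in (H_0^1(\Omega))^3\setminus\{0\}}|\langle\bm G,\bm v\rangle|/\|\bm v\|_{\epsilon,\Omega}$. *)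

theory Defs
  imports "HOL-Analysis.Analysis" "HOL-Probability.Essential_Supremum"
begin

type_synonym plane = "real ^ 2"
type_synonym scalar_fun = "plane \<Rightarrow> real"
type_synonym triple_fun = "scalar_fun \<times> scalar_fun \<times> scalar_fun"

section \<open>Bounded Lipschitz domains in the plane\<close>

text \<open>Near each boundary point the set lies strictly on one side of the graph of a Lipschitz
  function, in the orthonormal coordinates with axes \<open>a\<close> and \<open>b\<close> centred at that point.\<close>

definition lipschitz_boundary :: "plane set \<Rightarrow> bool" where
  "lipschitz_boundary \<Omega> \<longleftrightarrow>
    (\<forall>x\<in>frontier \<Omega>. \<exists>a b r L (\<gamma> :: real \<Rightarrow> real).
        norm a = 1 \<and> norm b = 1 \<and> a \<bullet> b = 0 \<and> r > 0 \<and> lipschitz_on L UNIV \<gamma> \<and>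
        \<Omega> \<inter> ball x r = {y \<in> ball x r. (y - x) \<bullet> b > \<gamma> ((y - x) \<bullet> a)})"

definition bounded_lipschitz_domain :: "plane set \<Rightarrow> bool" where
  "bounded_lipschitz_domain \<Omega> \<longleftrightarrow>
    open \<Omega> \<and> connected \<Omega> \<and> \<Omega> \<noteq> {} \<and> bounded \<Omega> \<and> lipschitz_boundary \<Omega>"

section \<open>Lebesgue and Sobolev spaces\<close>

text \<open>Elements of these spaces are represented by functions on the whole plane of which only the
  values almost everywhere on \<open>\<Omega>\<close> matter. The scalar and the vector valued case
  (the latter for gradients, with the pointwise Euclidean norm) are treated at once.\<close>

definition L2 :: "plane set \<Rightarrow> (plane \<Rightarrow> 'b::euclidean_space) set" where
  "L2 \<Omega> = {f. f \<in> borel_measurable (lebesgue_on \<Omega>) \<and>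
               integrable (lebesgue_on \<Omega>) (\<lambda>x. (norm (f x))\<^sup>2)}"

definition L2_norm :: "plane set \<Rightarrow> (plane \<Rightarrow> 'b::euclidean_space) \<Rightarrow> real" where
  "L2_norm \<Omega> f = sqrt (LINT x|lebesgue_on \<Omega>. (norm (f x))\<^sup>2)"

definition Linf :: "plane set \<Rightarrow> (plane \<Rightarrow> 'b::euclidean_space) set" where
  "Linf \<Omega> = {f. f \<in> borel_measurable (lebesgue_on \<Omega>) \<and>
                 esssup (lebesgue_on \<Omega>) (\<lambda>x. ereal (norm (f x))) < \<infinity>}"

text \<open>Only meaningful for members of \<open>Linf \<Omega>\<close>: the conversion to a real sends infinity to 0.\<close>

definition Linf_norm :: "plane set \<Rightarrow> (plane \<Rightarrow> 'b::euclidean_space) \<Rightarrow> real" where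
  "Linf_norm \<Omega> f = real_of_ereal (esssup (lebesgue_on \<Omega>) (\<lambda>x. ereal (norm (f x))))"

definition locally_integrable :: "plane set \<Rightarrow> (plane \<Rightarrow> 'b::euclidean_space) \<Rightarrow> bool" where
  "locally_integrable \<Omega> f \<longleftrightarrow> (\<forall>K. compact K \<and> K \<subseteq> \<Omega> \<longrightarrow> set_integrable lebesgue K f)"

text \<open>\<open>Ck k f\<close>: \<open>f\<close> is \<open>k\<close> times continuously differentiable, in terms of iterated
  directional derivatives.\<close>

primrec Ck :: "nat \<Rightarrow> scalar_fun \<Rightarrow> bool" where
  "Ck 0 f \<longleftrightarrow> continuous_on UNIV f"
| "Ck (Suc k) f \<longleftrightarrow> (\<forall>x. f differentiable (at x)) \<and>
                     (\<forall>v. Ck k (\<lambda>x. frechet_derivative f (at x) v))"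

definition test_fun :: "plane set \<Rightarrow> scalar_fun \<Rightarrow> bool" where
  "test_fun \<Omega> \<phi> \<longleftrightarrow> (\<forall>k. Ck k \<phi>) \<and>
     compact (closure {x. \<phi> x \<noteq> 0}) \<and> closure {x. \<phi> x \<noteq> 0} \<subseteq> \<Omega>"

definition grad :: "scalar_fun \<Rightarrow> plane \<Rightarrow> plane" where
  "grad \<phi> x = (\<chi> i. frechet_derivative \<phi> (at x) (axis i 1))"

definition has_weak_grad :: "plane set \<Rightarrow> scalar_fun \<Rightarrow> (plane \<Rightarrow> plane) \<Rightarrow> bool" where
  "has_weak_grad \<Omega> f g \<longleftrightarrow> locally_integrable \<Omega> f \<and> locally_integrable \<Omega> g \<and>
     (\<forall>\<phi>. test_fun \<Omega> \<phi> \<longrightarrow>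
        (LINT x|lebesgue_on \<Omega>. f x *\<^sub>R grad \<phi> x) = - (LINT x|lebesgue_on \<Omega>. \<phi> x *\<^sub>R g x))"

text \<open>A weak gradient is unique almost everywhere on an open set, so the choice is immaterial.\<close>

definition weak_grad :: "plane set \<Rightarrow> scalar_fun \<Rightarrow> plane \<Rightarrow> plane" where
  "weak_grad \<Omega> f = (SOME g. has_weak_grad \<Omega> f g)"

definition H1 :: "plane set \<Rightarrow> scalar_fun set" where
  "H1 \<Omega> = {f \<in> L2 \<Omega>. \<exists>g \<in> L2 \<Omega>. has_weak_grad \<Omega> f g}"

definition H1_norm :: "plane set \<Rightarrow> scalar_fun \<Rightarrow> real" where
  "H1_norm \<Omega> f = sqrt ((L2_norm \<Omega> f)\<^sup>2 + (L2_norm \<Omega> (weak_grad \<Omega> f))\<^sup>2)"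

definition H10 :: "plane set \<Rightarrow> scalar_fun set" where
  "H10 \<Omega> = {f \<in> H1 \<Omega>. \<exists>\<phi> :: nat \<Rightarrow> scalar_fun. (\<forall>k. test_fun \<Omega> (\<phi> k)) \<and>
               (\<lambda>k. H1_norm \<Omega> (\<lambda>x. f x - \<phi> k x)) \<longlonglongrightarrow> 0}"

definition W1inf :: "plane set \<Rightarrow> scalar_fun set" where
  "W1inf \<Omega> = {f \<in> Linf \<Omega>. \<exists>g \<in> Linf \<Omega>. has_weak_grad \<Omega> f g}"

text \<open>Equality of the traces on the boundary, in the usual weak sense.\<close>

definition same_boundary_values :: "plane set \<Rightarrow> scalar_fun \<Rightarrow> scalar_fun \<Rightarrow> bool" where
  "same_boundary_values \<Omega> f g \<longleftrightarrow> (\<lambda>x. f x - g x) \<in> H10 \<Omega>"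

definition poincare_constant :: "plane set \<Rightarrow> real \<Rightarrow> bool" where
  "poincare_constant \<Omega> C \<longleftrightarrow> (\<forall>v \<in> H10 \<Omega>. L2_norm \<Omega> v \<le> C * L2_norm \<Omega> (weak_grad \<Omega> v))"

abbreviation H10_3 :: "plane set \<Rightarrow> triple_fun set" where
  "H10_3 \<Omega> \<equiv> H10 \<Omega> \<times> H10 \<Omega> \<times> H10 \<Omega>"

section \<open>Weighted norms\<close>

definition eps_norm :: "plane set \<Rightarrow> real \<Rightarrow> scalar_fun \<Rightarrow> real" where
  "eps_norm \<Omega> \<epsilon> \<phi> = sqrt ((L2_norm \<Omega> \<phi>)\<^sup>2 + \<epsilon> * (L2_norm \<Omega> (weak_grad \<Omega> \<phi>))\<^sup>2)"

fun eps_norm3 :: "plane set \<Rightarrow> real \<Rightarrow> triple_fun \<Rightarrow> real" where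
  "eps_norm3 \<Omega> \<epsilon> (\<phi>1, \<phi>2, \<phi>3) =
     sqrt ((eps_norm \<Omega> \<epsilon> \<phi>1)\<^sup>2 + (eps_norm \<Omega> \<epsilon> \<phi>2)\<^sup>2 + (eps_norm \<Omega> \<epsilon> \<phi>3)\<^sup>2)"

fun zero_ae :: "plane set \<Rightarrow> triple_fun \<Rightarrow> bool" where
  "zero_ae \<Omega> (v1, v2, v3) \<longleftrightarrow> (AE x in lebesgue_on \<Omega>. v1 x = 0 \<and> v2 x = 0 \<and> v3 x = 0)"

text \<open>Dual norm of a functional on \<open>H10_3 \<Omega>\<close>. The supremum is a real one, hence only meaningful
  for bounded functionals.\<close>

definition dual_norm :: "plane set \<Rightarrow> real \<Rightarrow> (triple_fun \<Rightarrow> real) \<Rightarrow> real" where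
  "dual_norm \<Omega> \<epsilon> G = (SUP v \<in> {v \<in> H10_3 \<Omega>. \<not> zero_ae \<Omega> v}. \<bar>G v\<bar> / eps_norm3 \<Omega> \<epsilon> v)"

section \<open>The Poisson--Nernst--Planck operator and its Gateaux derivative\<close>

fun pnp_F :: "plane set \<Rightarrow> real \<Rightarrow> triple_fun \<Rightarrow> triple_fun \<Rightarrow> triple_fun \<Rightarrow> real" where
  "pnp_F \<Omega> \<epsilon> (f1, f2, f3) (p, n, \<psi>) (v1, v2, v3) =
    (let D = weak_grad \<Omega> in
     LINT x|lebesgue_on \<Omega>.
         D p x \<bullet> D v1 x + p x * (D \<psi> x \<bullet> D v1 x)
       + D n x \<bullet> D v2 x - n x * (D \<psi> x \<bullet> D v2 x)
       + \<epsilon> * (D \<psi> x \<bullet> D v3 x) - p x * v3 x + n x * v3 x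
       - f1 x * v1 x - f2 x * v2 x - f3 x * v3 x)"

fun pnp_DF :: "plane set \<Rightarrow> real \<Rightarrow> triple_fun \<Rightarrow> triple_fun \<Rightarrow> triple_fun \<Rightarrow> real" where
  "pnp_DF \<Omega> \<epsilon> (p, n, \<psi>) (\<phi>1, \<phi>2, \<phi>3) (v1, v2, v3) =
    (let D = weak_grad \<Omega> in
     LINT x|lebesgue_on \<Omega>.
         D \<phi>1 x \<bullet> D v1 x + p x * (D \<phi>3 x \<bullet> D v1 x) + \<phi>1 x * (D \<psi> x \<bullet> D v1 x)
       + D \<phi>2 x \<bullet> D v2 x - n x * (D \<phi>3 x \<bullet> D v2 x) - \<phi>2 x * (D \<psi> x \<bullet> D v2 x)
       + \<epsilon> * (D \<phi>3 x \<bullet> D v3 x) - \<phi>1 x * v3 x + \<phi>2 x * v3 x)"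

section \<open>Piecewise linear finite elements\<close>

text \<open>Conforming triangulations by closed nondegenerate triangles, with mesh size \<open>h\<close> and
  quasi-uniformity constant \<open>\<sigma>\<close>: the inradius of every triangle is at least \<open>\<sigma> h\<close>.
  Conformity, i.e. the intersection of two triangles is a common face (possibly empty), is part of
  the library notion \<open>triangulation\<close>.\<close>

definition quasi_uniform_triangulation ::
    "plane set \<Rightarrow> real \<Rightarrow> real \<Rightarrow> plane set set \<Rightarrow> bool" where
  "quasi_uniform_triangulation \<Omega> \<sigma> h \<T> \<longleftrightarrow>
     triangulation \<T> \<and> (\<forall>T\<in>\<T>. 2 simplex T) \<and> \<Union>\<T> = closure \<Omega> \<and>
     h = Max (diameter ` \<T>) \<and> (\<forall>T\<in>\<T>. \<exists>x. ball x (\<sigma> * h) \<subseteq> T)"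

definition piecewise_P1 :: "plane set set \<Rightarrow> scalar_fun \<Rightarrow> bool" where
  "piecewise_P1 \<T> v \<longleftrightarrow> (\<forall>T\<in>\<T>. \<exists>a c. AE x in lebesgue_on T. v x = a \<bullet> x + c)"

definition fe_space :: "plane set \<Rightarrow> plane set set \<Rightarrow> scalar_fun set" where
  "fe_space \<Omega> \<T> = {v \<in> H10 \<Omega>. piecewise_P1 \<T> v}"

text \<open>The finite element approximation of \<open>(p, n, \<psi>)\<close>.\<close>

fun fe_solution :: "plane set \<Rightarrow> real \<Rightarrow> triple_fun \<Rightarrow> plane set set \<Rightarrow> triple_fun \<Rightarrow> triple_fun \<Rightarrow> bool"
  where
  "fe_solution \<Omega> \<epsilon> f \<T> (p, n, \<psi>) (ph, nh, \<psi>h) \<longleftrightarrow>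
     ph \<in> H1 \<Omega> \<and> nh \<in> H1 \<Omega> \<and> \<psi>h \<in> H1 \<Omega> \<and>
     piecewise_P1 \<T> ph \<and> piecewise_P1 \<T> nh \<and> piecewise_P1 \<T> \<psi>h \<and>
     same_boundary_values \<Omega> p ph \<and> same_boundary_values \<Omega> n nh \<and> same_boundary_values \<Omega> \<psi> \<psi>h \<and>
     (\<forall>vh \<in> fe_space \<Omega> \<T> \<times> fe_space \<Omega> \<T> \<times> fe_space \<Omega> \<T>. pnp_F \<Omega> \<epsilon> f (ph, nh, \<psi>h) vh = 0)"

end

theory Submission
  imports Defs
begin

text \<open>Since \<open>pnp_F\<close> is quadratic, \<open>F(u\<^sub>h) = F(u) - DF(u) e + N(e)\<close> exactly, where
  \<open>\<langle>N(e), v\<rangle> = \<integral> e\<^sub>1 \<nabla>e\<^sub>3 \<cdot> \<nabla>v\<^sub>1 - e\<^sub>2 \<nabla>e\<^sub>3 \<cdot> \<nabla>v\<^sub>2\<close>, and \<open>F(u) = 0\<close>. If \<open>e\<^sub>1\<close> and \<open>e\<^sub>2\<close> are bounded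
  by \<open>\<delta>\<close>, the dual norm of \<open>N(e)\<close> is at most \<open>2 \<delta> / \<epsilon>\<close> times the norm of \<open>e\<close>, so for
  \<open>\<delta> = \<epsilon> / (4 C\<^sub>2)\<close> the dual norms of \<open>F(u\<^sub>h)\<close> and \<open>DF(u) e\<close> differ by at most
  \<open>\<parallel>e\<parallel> / (2 C\<^sub>2)\<close>, and both bounds follow from the two-sided estimate for \<open>DF(u) e\<close>.

  The expansion needs linearity of the (chosen) weak gradient, hence its uniqueness almost everywhere,
  i.e. the du Bois-Reymond lemma. It suffices to test with smooth functions converging
  boundedly to indicators of boxes, which generate the Borel sets.\<close>

section \<open>Smooth approximations of indicators of boxes\<close>

text \<open>For \<open>j = 0\<close> this is the classical smooth function that is flat at 0. The
  powers of \<open>s\<close> in the denominator are those that differentiation produces, so up to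
  linear combinations the family is closed under derivatives.\<close>

definition exp_bump :: "nat \<Rightarrow> real \<Rightarrow> real" where
  "exp_bump j s = (if s > 0 then exp (- 1 / s) / s ^ j else 0)"

lemma exp_bump_nonneg: "0 \<le> exp_bump j s"
  by (simp add: exp_bump_def)

lemma exp_bump_0_le_1: "exp_bump 0 s \<le> 1"
  by (simp add: exp_bump_def)

lemma exp_bump_0_eq_0_iff: "exp_bump 0 s = 0 \<longleftrightarrow> s \<le> 0"
  by (simp add: exp_bump_def)

text \<open>A single term of the exponential series at \<open>1 / s\<close> is at most
  \<open>exp (1 / s)\<close>, so \<open>exp (- 1 / s)\<close> beats every negative power of
  \<open>s\<close>. This controls the difference quotients at 0.\<close>

lemma exp_bump_le_power: "exp_bump j s \<le> fact (j + k) * \<bar>s\<bar> ^ k"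
proof (cases "s > 0")
  case True
  have "(1 / s) ^ (j + k) / fact (j + k) \<le> exp (1 / s)"
    using sums_le[OF _ sums_single[of "j + k" "\<lambda>n. (1 / s) ^ n / fact n"] exp_converges[of "1 / s"]] True
    by (auto simp: divide_inverse mult.commute)
  then have "exp (- (1 / s)) * ((1 / s) ^ (j + k) / fact (j + k)) \<le> exp (- (1 / s)) * exp (1 / s)"
    by (intro mult_left_mono) auto
  then have "exp (- (1 / s)) / (s ^ j * s ^ k * fact (j + k)) \<le> 1"
    by (simp add: exp_minus power_add power_divide field_simps)
  with True show ?thesis
    by (simp add: exp_bump_def field_simps)
qed (simp add: exp_bump_def)

text \<open>On the positive half-line this is the quotient rule, and on the negative one the
  function is constant. At 0, \<open>exp_bump_le_power\<close> with \<open>k = 2\<close> bounds the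
  difference quotient by a multiple of \<bar>h\<bar>.\<close>

lemma has_real_derivative_exp_bump:
  "(exp_bump j has_real_derivative (exp_bump (j + 2) s - real j * exp_bump (j + 1) s)) (at s)"
proof -
  consider "s > 0" | "s = 0" | "s < 0" by linarith
  then show ?thesis
  proof cases
    case 1
    \<comment> \<open>The truncated subtraction does no harm: for \<open>j = 0\<close> the factor
      \<open>real j\<close> vanishes.\<close>
    have "real j * s ^ (j - 1) = real j * s ^ j / s"
      using 1 by (cases j) auto
    then have eq: "(exp (- 1 / s) * (1 / s\<^sup>2) * s ^ j - exp (- 1 / s) * (real j * s ^ (j - 1))) / (s ^ j * s ^ j)
        = exp_bump (j + 2) s - real j * exp_bump (j + 1) s"
      using 1 by (auto simp: exp_bump_def field_simps power2_eq_square)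
    have "((\<lambda>s. exp (- 1 / s)) has_real_derivative exp (- 1 / s) * (1 / s\<^sup>2)) (at s)"
      using 1 by (auto intro!: derivative_eq_intros simp: power2_eq_square)
    from DERIV_divide[OF this DERIV_pow] 1
    have "((\<lambda>s. exp (- 1 / s) / s ^ j) has_real_derivative
        (exp_bump (j + 2) s - real j * exp_bump (j + 1) s)) (at s)"
      unfolding eq[symmetric] by simp
    moreover have "eventually (\<lambda>t. exp (- 1 / t) / t ^ j = exp_bump j t) (nhds s)"
      using eventually_nhds_in_open[of "{0<..}" s] 1
      by (auto elim!: eventually_mono simp: exp_bump_def)
    ultimately show ?thesis
      by (subst (asm) DERIV_cong_ev[OF refl _ refl])
  next
    case 2
    have "((\<lambda>h. exp_bump j h / h) \<longlongrightarrow> 0) (at 0)"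
    proof (rule Lim_null_comparison)
      show "eventually (\<lambda>h. norm (exp_bump j h / h) \<le> fact (j + 2) * \<bar>h\<bar>) (at 0)"
      proof (intro always_eventually allI)
        fix h :: real
        show "norm (exp_bump j h / h) \<le> fact (j + 2) * \<bar>h\<bar>"
        proof (cases "h = 0")
          case False
          have "exp_bump j h \<le> fact (j + 2) * \<bar>h\<bar> * \<bar>h\<bar>"
            using exp_bump_le_power[of j h 2] by (simp only: power2_eq_square mult.assoc)
          then have "exp_bump j h / \<bar>h\<bar> \<le> fact (j + 2) * \<bar>h\<bar>"
            using False by (subst pos_divide_le_eq) auto
          then show ?thesis
            by (simp only: real_norm_def abs_divide abs_of_nonneg[OF exp_bump_nonneg])
        qed simp
      qed
      show "((\<lambda>h. fact (j + 2) * \<bar>h\<bar>) \<longlongrightarrow> (0::real)) (at 0)"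
        by (auto intro!: tendsto_eq_intros)
    qed
    then show ?thesis
      using 2 by (simp add: DERIV_def exp_bump_def)
  next
    case 3
    have "((\<lambda>s. 0) has_real_derivative 0) (at s)" by simp
    moreover have "eventually (\<lambda>t. 0 = exp_bump j t) (nhds s)"
      using eventually_nhds_in_open[of "{..<0}" s] 3
      by (auto elim!: eventually_mono simp: exp_bump_def)
    ultimately show ?thesis
      using 3 by (subst (asm) DERIV_cong_ev[OF refl _ refl]) (auto simp: exp_bump_def)
  qed
qed

text \<open>This class is closed under directional derivatives, because
  \<open>exp_bump j\<close> has derivative \<open>exp_bump (j + 2) - j exp_bump (j + 1)\<close>; hence its members are smooth.\<close>

inductive bump_algebra :: "scalar_fun \<Rightarrow> bool" where
  const: "bump_algebra (\<lambda>x. c)"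
| affine: "bump_algebra (\<lambda>x. exp_bump j (u \<bullet> x + c))"
| add: "bump_algebra f \<Longrightarrow> bump_algebra g \<Longrightarrow> bump_algebra (\<lambda>x. f x + g x)"
| mult: "bump_algebra f \<Longrightarrow> bump_algebra g \<Longrightarrow> bump_algebra (\<lambda>x. f x * g x)"

lemma bump_algebra_prod:
  "finite I \<Longrightarrow> (\<And>i. i \<in> I \<Longrightarrow> bump_algebra (f i)) \<Longrightarrow> bump_algebra (\<lambda>x. \<Prod>i\<in>I. f i x)"
  by (induction I rule: finite_induct) (auto intro: bump_algebra.const bump_algebra.mult)

text \<open>By the chain rule for the generators and the product rule for products. The derivative
  and the membership of its directional values are proved together because the product case uses
  both for its factors.\<close>

lemma bump_algebra_has_derivative:
  assumes "bump_algebra f"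
  shows "\<exists>f'. (\<forall>x. (f has_derivative f' x) (at x)) \<and> (\<forall>v. bump_algebra (\<lambda>x. f' x v))"
  using assms
proof induction
  case (const c)
  then show ?case
    by (intro exI[of _ "\<lambda>x v. 0"]) (auto intro: bump_algebra.const)
next
  case (affine j u c)
  \<comment> \<open>The derivative is written as a sum with a negative coefficient, since
    \<open>bump_algebra\<close> has rules for sums and products but none for differences.\<close>
  let ?d = "\<lambda>x. exp_bump (j + 2) (u \<bullet> x + c) + (- real j) * exp_bump (j + 1) (u \<bullet> x + c)"
  have "((\<lambda>x. exp_bump j (u \<bullet> x + c)) has_derivative (\<lambda>v. ?d x * (u \<bullet> v))) (at x)" for x
  proof -
    have "((\<lambda>x. u \<bullet> x + c) has_derivative (\<lambda>v. u \<bullet> v)) (at x)"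
      by (auto intro!: derivative_eq_intros)
    from has_derivative_compose[OF this
        has_real_derivative_exp_bump[of j "u \<bullet> x + c", unfolded has_field_derivative_def]]
    show ?thesis by simp
  qed
  moreover have "bump_algebra (\<lambda>x. ?d x * (u \<bullet> v))" for v
    by (intro bump_algebra.intros)
  ultimately show ?case by (intro exI[of _ "\<lambda>x v. ?d x * (u \<bullet> v)"]) auto
next
  case (add f g)
  then obtain f' g' where
    "\<forall>x. (f has_derivative f' x) (at x)" "\<forall>v. bump_algebra (\<lambda>x. f' x v)"
    "\<forall>x. (g has_derivative g' x) (at x)" "\<forall>v. bump_algebra (\<lambda>x. g' x v)" by blast
  then show ?case
    by (intro exI[of _ "\<lambda>x v. f' x v + g' x v"])
      (auto intro!: derivative_eq_intros bump_algebra.intros)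
next
  case (mult f g)
  then obtain f' g' where *:
    "\<forall>x. (f has_derivative f' x) (at x)" "\<forall>v. bump_algebra (\<lambda>x. f' x v)"
    "\<forall>x. (g has_derivative g' x) (at x)" "\<forall>v. bump_algebra (\<lambda>x. g' x v)" by blast
  then have "((\<lambda>x. f x * g x) has_derivative (\<lambda>v. f x * g' x v + f' x v * g x)) (at x)" for x
    by (auto intro!: has_derivative_mult)
  with * mult.hyps show ?case
    by (intro exI[of _ "\<lambda>x v. f x * g' x v + f' x v * g x"])
      (auto intro!: bump_algebra.intros)
qed

lemma bump_algebra_Ck: "bump_algebra f \<Longrightarrow> Ck k f"
proof (induction k arbitrary: f)
  case 0
  then obtain f' where "\<forall>x. (f has_derivative f' x) (at x)"
    using bump_algebra_has_derivative by blast
  then show ?case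
    by (auto simp: continuous_on_eq_continuous_at intro: has_derivative_continuous)
next
  case (Suc k)
  then obtain f' where f': "\<forall>x. (f has_derivative f' x) (at x)" "\<forall>v. bump_algebra (\<lambda>x. f' x v)"
    using bump_algebra_has_derivative by blast
  then have "frechet_derivative f (at x) = f' x" for x
    using frechet_derivative_at by metis
  with f' Suc.IH show ?case
    by (auto simp: differentiable_def)
qed

text \<open>Each factor measures the distance to one face of the box, scaled by
  \<open>k + 1\<close>. Using \<open>Suc k\<close> keeps the scale positive, so for every
  \<open>k\<close> the zero set is exactly the complement of the open box.\<close>

definition box_bump :: "plane \<Rightarrow> plane \<Rightarrow> nat \<Rightarrow> scalar_fun" where
  "box_bump a b k x =
     (\<Prod>i\<in>Basis. exp_bump 0 (real (Suc k) * ((x - a) \<bullet> i)) * exp_bump 0 (real (Suc k) * ((b - x) \<bullet> i)))"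

lemma box_bump_Ck: "Ck m (box_bump a b k)"
proof -
  have "bump_algebra (\<lambda>x. \<Prod>i\<in>Basis. exp_bump 0 ((real (Suc k) *\<^sub>R i) \<bullet> x + (- real (Suc k) * (a \<bullet> i))) *
      exp_bump 0 ((- real (Suc k) *\<^sub>R i) \<bullet> x + real (Suc k) * (b \<bullet> i)))"
    by (intro bump_algebra_prod bump_algebra.intros finite_Basis)
  also have "(\<lambda>x. \<Prod>i\<in>Basis. exp_bump 0 ((real (Suc k) *\<^sub>R i) \<bullet> x + (- real (Suc k) * (a \<bullet> i))) *
      exp_bump 0 ((- real (Suc k) *\<^sub>R i) \<bullet> x + real (Suc k) * (b \<bullet> i))) = box_bump a b k"
    unfolding box_bump_def
    by (intro ext prod.cong refl arg_cong2[where f = "(*)"] arg_cong[where f = "exp_bump 0"])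
      (simp_all add: inner_simps inner_commute algebra_simps)
  finally show ?thesis by (rule bump_algebra_Ck)
qed

lemma box_bump_eq_0_iff: "box_bump a b k x = 0 \<longleftrightarrow> x \<notin> box a b"
  by (simp add: box_bump_def exp_bump_0_eq_0_iff mem_box inner_simps mult_le_0_iff) (meson not_le)

lemma box_bump_bounds: "0 \<le> box_bump a b k x" "box_bump a b k x \<le> 1"
  unfolding box_bump_def
  by (auto intro!: prod_nonneg prod_le_1 mult_nonneg_nonneg mult_le_one exp_bump_nonneg exp_bump_0_le_1)

lemma test_fun_box_bump:
  assumes "cbox a b \<subseteq> \<Omega>"
  shows "test_fun \<Omega> (box_bump a b k)"
proof -
  have "{x. box_bump a b k x \<noteq> 0} = box a b"
    by (auto simp: box_bump_eq_0_iff)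
  moreover have "closure (box a b) \<subseteq> cbox a b"
    by (intro closure_minimal box_subset_cbox closed_cbox)
  moreover have "compact (closure (box a b))"
    using bounded_box by auto
  ultimately show ?thesis
    using assms by (auto simp: test_fun_def box_bump_Ck)
qed

text \<open>Inside the box every argument grows linearly in \<open>k\<close>, and
  \<open>exp (- 1 / s)\<close> tends to 1 as \<open>s\<close> grows; outside the box every member of
  the sequence is 0.\<close>

lemma tendsto_box_bump: "(\<lambda>k. box_bump a b k x) \<longlonglongrightarrow> indicator (box a b) x"
proof (cases "x \<in> box a b")
  case True
  have *: "(\<lambda>k. exp_bump 0 (real (Suc k) * s)) \<longlonglongrightarrow> 1" if "s > 0" for s
  proof -
    have "(\<lambda>k. exp (- (1 / s) * inverse (real (Suc k)))) \<longlonglongrightarrow> exp (- (1 / s) * 0)"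
      by (intro tendsto_intros LIMSEQ_inverse_real_of_nat)
    moreover have "exp_bump 0 (real (Suc k) * s) = exp (- (1 / s) * inverse (real (Suc k)))" for k
      using that by (simp add: exp_bump_def field_simps del: of_nat_Suc)
    ultimately show ?thesis by simp
  qed
  have "(\<lambda>k. box_bump a b k x) \<longlonglongrightarrow> (\<Prod>i::plane\<in>Basis. 1 * 1)"
    unfolding box_bump_def using True
    by (intro tendsto_prod tendsto_mult *) (auto simp: mem_box inner_simps)
  with True show ?thesis by simp
next
  case False
  then have "box_bump a b k x = 0" for k by (simp add: box_bump_eq_0_iff)
  with False show ?thesis by simp
qed

section \<open>Uniqueness of weak gradients\<close>

lemma sigma_finite_lebesgue: "sigma_finite_measure (lebesgue :: 'a::euclidean_space measure)"
proof
  from lborel.sigma_finite_countable obtain A :: "'a set set"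
    where "countable A" "A \<subseteq> sets lborel" "\<Union>A = space lborel" "\<forall>a\<in>A. emeasure lborel a \<noteq> \<infinity>"
    by blast
  then show "\<exists>A::'a set set. countable A \<and> A \<subseteq> sets lebesgue \<and> \<Union>A = space lebesgue \<and>
      (\<forall>a\<in>A. emeasure lebesgue a \<noteq> \<infinity>)"
    by (intro exI[of _ A]) auto
qed

text \<open>Boxes are an intersection-stable generator of the Borel sets, so a Dynkin argument
  carries the vanishing of the integral from boxes to Borel sets. A Lebesgue set differs from a
  Borel set by a negligible one, and a function whose integral over every measurable set vanishes is
  zero almost everywhere.\<close>

lemma AE_zero_if_box_integrals_zero:
  fixes f :: "'a::euclidean_space \<Rightarrow> 'b::{second_countable_topology, banach}"
  assumes f: "integrable lebesgue f"
    and box: "\<And>c d. (LINT x:box c d|lebesgue. f x) = 0"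
  shows "AE x in lebesgue. f x = 0"
proof (rule sigma_finite_measure.density_zero[OF sigma_finite_lebesgue f])
  have f_meas[measurable]: "f \<in> borel_measurable lebesgue" using f by auto
  have f_on: "set_integrable lebesgue A f" if "A \<in> sets lebesgue" for A
    unfolding set_integrable_def using integrable_mult_indicator[OF that f] .
  let ?G = "range (\<lambda>(a, b). box a b :: 'a set)"
  have sets_G: "sigma_sets UNIV ?G = sets borel"
    by (simp add: borel_eq_box)
  \<comment> \<open>The complement step of the Dynkin induction subtracts from the integral over the
    whole space, which is obtained here by exhausting the space with boxes.\<close>
  have whole: "(LINT x|lebesgue. f x) = 0"
  proof -
    let ?B = "\<lambda>n::nat. box (- (real n *\<^sub>R One)) (real n *\<^sub>R One) :: 'a set"
    have "(\<lambda>n. LINT x|lebesgue. indicator (?B n) x *\<^sub>R f x) \<longlonglongrightarrow> (LINT x|lebesgue. f x)"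
    proof (rule integral_dominated_convergence[where w = "\<lambda>x. norm (f x)"])
      show "AE x in lebesgue. (\<lambda>n. indicator (?B n) x *\<^sub>R f x) \<longlonglongrightarrow> f x"
      proof (intro always_eventually allI)
        fix x :: 'a
        have "x \<in> (\<Union>n. ?B n)" by (simp add: UN_box_eq_UNIV)
        then obtain N where "x \<in> ?B N" by auto
        then have "x \<in> ?B n" if "n \<ge> N" for n
          using that by (force simp: mem_box)
        then have "eventually (\<lambda>n. indicator (?B n) x *\<^sub>R f x = f x) sequentially"
          by (auto simp: eventually_sequentially intro!: exI[of _ N])
        then show "(\<lambda>n. indicator (?B n) x *\<^sub>R f x) \<longlonglongrightarrow> f x"
          by (rule tendsto_eventually)
      qed
      show "(\<lambda>x. indicator (?B n) x *\<^sub>R f x) \<in> borel_measurable lebesgue" for n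
        using f_on[of "?B n"] by (simp add: set_integrable_def)
    qed (use f in \<open>auto split: split_indicator\<close>)
    moreover have "(LINT x|lebesgue. indicator (?B n) x *\<^sub>R f x) = 0" for n
      using box unfolding set_lebesgue_integral_def .
    ultimately have "(\<lambda>n. 0) \<longlonglongrightarrow> (LINT x|lebesgue. f x)"
      by (simp only:)
    then show ?thesis
      by (simp add: LIMSEQ_const_iff)
  qed
  have borel: "(LINT x:A|lebesgue. f x) = 0" if "A \<in> sets borel" for A
  proof -
    have "Int_stable ?G" "?G \<subseteq> Pow UNIV" "A \<in> sigma_sets UNIV ?G"
      using that by (auto simp: Int_stable_def box_Int_box sets_G)
    then show ?thesis
    proof (induction rule: sigma_sets_induct_disjoint)
      case (compl A)
      then have A: "A \<in> sets lebesgue" by (simp add: sets_G)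
      have "(LINT x:A \<union> (UNIV - A)|lebesgue. f x) = (LINT x:A|lebesgue. f x) + (LINT x:UNIV - A|lebesgue. f x)"
        using A by (intro set_integral_Un f_on) auto
      then show ?case
        using compl whole by (simp add: set_lebesgue_integral_def)
    next
      case (union A)
      then have A: "\<And>i. A i \<in> sets lebesgue" by (auto simp: sets_G)
      show ?case
        using union A by (subst lebesgue_integral_countable_add) (auto intro!: f_on simp: disjoint_family_on_def)
    qed (use box in \<open>auto simp: set_lebesgue_integral_def\<close>)
  qed
  fix A :: "'a set" assume A: "A \<in> sets lebesgue"
  obtain B N where B: "B \<in> sets borel" "negligible N" "B \<union> N = A"
    using sets_lebesgue_almost_borel[OF A] .
  have "(LINT x:A|lebesgue. f x) = (LINT x:B|lebesgue. f x)"
    unfolding set_lebesgue_integral_def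
  proof (rule integral_cong_AE)
    have "AE x in lebesgue. x \<notin> N"
      using B(2) AE_not_in negligible_iff_null_sets by blast
    then show "AE x in lebesgue. indicat_real A x *\<^sub>R f x = indicat_real B x *\<^sub>R f x"
      by eventually_elim (use B in \<open>auto split: split_indicator\<close>)
    show "(\<lambda>x. indicat_real A x *\<^sub>R f x) \<in> borel_measurable lebesgue"
      using f_on[OF A] by (simp add: set_integrable_def)
    show "(\<lambda>x. indicat_real B x *\<^sub>R f x) \<in> borel_measurable lebesgue"
      using f_on[of B] B by (simp add: set_integrable_def)
  qed
  with borel B show "(LINT x:A|lebesgue. f x) = 0" by simp
qed

lemma borel_measurable_lebesgue_continuous:
  fixes f :: "'a::euclidean_space \<Rightarrow> 'b::topological_space"
  shows "continuous_on UNIV f \<Longrightarrow> f \<in> borel_measurable lebesgue"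
  by (intro measurable_completion) (simp add: borel_measurable_continuous_onI)

text \<open>Testing with box bumps and passing to the limit shows that \<open>g\<close> has integral
  0 over each open box whose closed box lies in \<open>\<Omega>\<close>. Hence \<open>g\<close>
  vanishes almost everywhere on each closed box in \<open>\<Omega>\<close>, and countably many of
  these cover \<open>\<Omega>\<close>.\<close>

lemma du_Bois_Reymond:
  fixes g :: "plane \<Rightarrow> 'b::euclidean_space"
  assumes "open \<Omega>" and g: "locally_integrable \<Omega> g"
    and test: "\<And>\<phi>. test_fun \<Omega> \<phi> \<Longrightarrow> (LINT x|lebesgue_on \<Omega>. \<phi> x *\<^sub>R g x) = 0"
  shows "AE x in lebesgue_on \<Omega>. g x = 0"
proof -
  have small_box: "(LINT x:box l u|lebesgue. g x) = 0" if lu: "cbox l u \<subseteq> \<Omega>" for l u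
  proof -
    \<comment> \<open>Only on compact subsets of \<open>\<Omega>\<close> is \<open>g\<close> known
      to be integrable. The indicator of the closed box can be inserted freely because the bumps
      vanish outside the open box; the cut-off \<open>g\<close> then serves as dominating
      function.\<close>
    have int: "integrable lebesgue (\<lambda>x. indicator (cbox l u) x *\<^sub>R g x)"
      using g lu by (auto simp: locally_integrable_def set_integrable_def)
    have "(\<lambda>k. LINT x|lebesgue. box_bump l u k x *\<^sub>R indicator (cbox l u) x *\<^sub>R g x)
        \<longlonglongrightarrow> (LINT x|lebesgue. indicator (box l u) x *\<^sub>R indicator (cbox l u) x *\<^sub>R g x)"
    proof (rule integral_dominated_convergence[where w = "\<lambda>x. norm (indicator (cbox l u) x *\<^sub>R g x)"])
      show "AE x in lebesgue. (\<lambda>k. box_bump l u k x *\<^sub>R indicator (cbox l u) x *\<^sub>R g x)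
          \<longlonglongrightarrow> indicator (box l u) x *\<^sub>R indicator (cbox l u) x *\<^sub>R g x"
        by (intro always_eventually allI tendsto_scaleR tendsto_box_bump tendsto_const)
      show "AE x in lebesgue. norm (box_bump l u k x *\<^sub>R indicator (cbox l u) x *\<^sub>R g x)
          \<le> norm (indicator (cbox l u) x *\<^sub>R g x)" for k
        using box_bump_bounds[of l u k]
        by (intro always_eventually allI)
          (auto simp: mult.assoc intro!: mult_left_le_one_le mult_nonneg_nonneg)
      have "box_bump l u k \<in> borel_measurable lebesgue" for k
        using box_bump_Ck[of 0] by (intro borel_measurable_lebesgue_continuous) simp
      then show "(\<lambda>x. box_bump l u k x *\<^sub>R indicator (cbox l u) x *\<^sub>R g x) \<in> borel_measurable lebesgue" for k
        using borel_measurable_integrable[OF int] by (rule borel_measurable_scaleR)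
      show "(\<lambda>x. indicator (box l u) x *\<^sub>R indicator (cbox l u) x *\<^sub>R g x) \<in> borel_measurable lebesgue"
        using integrable_mult_indicator[OF _ int, of "box l u"] by simp
    qed (rule integrable_norm[OF int])
    moreover have "(LINT x|lebesgue. box_bump l u k x *\<^sub>R indicator (cbox l u) x *\<^sub>R g x) = 0" for k
    proof -
      have "(\<lambda>x. indicator \<Omega> x *\<^sub>R box_bump l u k x *\<^sub>R g x) =
          (\<lambda>x. box_bump l u k x *\<^sub>R indicator (cbox l u) x *\<^sub>R g x)"
        using lu box_bump_eq_0_iff[of l u k] box_subset_cbox[of l u]
        by (fastforce simp: fun_eq_iff split: split_indicator)
      then show ?thesis
        using test[OF test_fun_box_bump[OF lu, of k]] \<open>open \<Omega>\<close>
        by (simp add: integral_restrict_space)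
    qed
    moreover have "(LINT x|lebesgue. indicator (box l u) x *\<^sub>R indicator (cbox l u) x *\<^sub>R g x)
        = (LINT x:box l u|lebesgue. g x)"
      unfolding set_lebesgue_integral_def using box_subset_cbox[of l u]
      by (intro Bochner_Integration.integral_cong) (auto split: split_indicator)
    ultimately have "(\<lambda>n. 0) \<longlonglongrightarrow> (LINT x:box l u|lebesgue. g x)"
      by (simp only:)
    then show ?thesis
      by (simp add: LIMSEQ_const_iff)
  qed
  have AE_cbox: "AE x in lebesgue. x \<in> cbox a b \<longrightarrow> g x = 0" if ab: "cbox a b \<subseteq> \<Omega>" for a b
  proof -
    have "AE x in lebesgue. indicator (box a b) x *\<^sub>R g x = 0"
    proof (rule AE_zero_if_box_integrals_zero)
      have "set_integrable lebesgue (cbox a b) g"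
        using g ab compact_cbox unfolding locally_integrable_def by blast
      then have "set_integrable lebesgue (box a b) g"
        by (rule set_integrable_subset) (simp_all add: box_subset_cbox)
      then show "integrable lebesgue (\<lambda>x. indicator (box a b) x *\<^sub>R g x)"
        by (simp add: set_integrable_def)
      fix c d
      obtain l u where lu: "box c d \<inter> box a b = box l u"
        using that[OF box_Int_box] .
      have "(LINT x:box l u|lebesgue. g x) = 0"
      \<comment> \<open>When the open box is empty, \<open>cbox l u\<close> may still be nonempty
        and lie outside \<open>\<Omega>\<close>, so \<open>small_box\<close> is reserved for the
        nonempty case.\<close>
      proof (cases "box l u = {}")
        case False
        then have "box a b \<noteq> {}" "closure (box l u) \<subseteq> closure (box a b)"
          using lu by (blast, intro closure_mono) blast
        with False have "cbox l u \<subseteq> cbox a b" by simp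
        with ab show ?thesis by (intro small_box) blast
      qed (simp add: set_lebesgue_integral_def)
      then show "(LINT x:box c d|lebesgue. indicator (box a b) x *\<^sub>R g x) = 0"
        unfolding set_lebesgue_integral_def lu[symmetric] by (simp add: indicator_inter_arith)
    qed
    \<comment> \<open>The faces of a box are negligible, so the open box may be replaced by the
      closed one.\<close>
    moreover have "AE x in lebesgue. x \<notin> cbox a b - box a b"
      using negligible_frontier_interval[of a b] AE_not_in negligible_iff_null_sets by blast
    ultimately show ?thesis
      by eventually_elim auto
  qed
  obtain D where D: "countable D" "D \<subseteq> Pow \<Omega>" "\<And>X. X \<in> D \<Longrightarrow> \<exists>a b. X = cbox a b" "\<Union>D = \<Omega>"
    using open_countable_Union_open_cbox[OF \<open>open \<Omega>\<close>] by blast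
  have "AE x in lebesgue. \<forall>X\<in>D. x \<in> X \<longrightarrow> g x = 0"
  proof (subst AE_ball_countable[OF \<open>countable D\<close>], intro ballI)
    fix X assume "X \<in> D"
    with D obtain a b where "X = cbox a b" "X \<subseteq> \<Omega>" by blast
    then show "AE x in lebesgue. x \<in> X \<longrightarrow> g x = 0" using AE_cbox by blast
  qed
  then have "AE x in lebesgue. x \<in> \<Omega> \<longrightarrow> g x = 0"
    by eventually_elim (use D in auto)
  with \<open>open \<Omega>\<close> show ?thesis
    by (simp add: AE_restrict_space_iff)
qed

section \<open>Integrability against test functions and their gradients\<close>

lemma locally_integrable_diff:
  "locally_integrable \<Omega> f \<Longrightarrow> locally_integrable \<Omega> g \<Longrightarrow> locally_integrable \<Omega> (\<lambda>x. f x - g x)"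
  by (auto simp: locally_integrable_def intro!: set_integral_diff)

text \<open>The bound forces \<open>h\<close> to vanish off \<open>K\<close>, so \<open>h\<close> is
  dominated on the whole plane by a multiple of the integrable function \<open>g\<close> cut off to
  \<open>K\<close>.\<close>

lemma integrable_locally_dominated:
  fixes g :: "plane \<Rightarrow> 'b::euclidean_space" and h :: "plane \<Rightarrow> 'c::euclidean_space"
  assumes "open \<Omega>" "locally_integrable \<Omega> g" "compact K" "K \<subseteq> \<Omega>"
    and h: "h \<in> borel_measurable lebesgue"
    and le: "\<And>x. norm (h x) \<le> B * norm (indicator K x *\<^sub>R g x)"
  shows "integrable (lebesgue_on \<Omega>) h"
proof -
  have "integrable lebesgue (\<lambda>x. indicator K x *\<^sub>R g x)"
    using assms by (auto simp: locally_integrable_def set_integrable_def)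
  then have "integrable lebesgue (\<lambda>x. B *\<^sub>R norm (indicator K x *\<^sub>R g x))"
    by (intro integrable_scaleR_right integrable_norm)
  then have "integrable lebesgue h"
  proof (rule Bochner_Integration.integrable_bound[OF _ h])
    show "AE x in lebesgue. norm (h x) \<le> norm (B *\<^sub>R norm (indicator K x *\<^sub>R g x))"
    proof (intro always_eventually allI)
      show "norm (h x) \<le> norm (B *\<^sub>R norm (indicator K x *\<^sub>R g x))" for x
        using le[of x] by simp
    qed
  qed
  with \<open>open \<Omega>\<close> show ?thesis
    by (simp add: integrable_restrict_space integrable_mult_indicator)
qed

lemma bounded_if_compact_support:
  fixes f :: "'a::topological_space \<Rightarrow> 'b::real_normed_vector"
  assumes "continuous_on UNIV f" "compact K" "\<And>x. x \<notin> K \<Longrightarrow> f x = 0"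
  obtains B where "\<And>x. norm (f x) \<le> B"
proof -
  have "bounded (f ` K)"
    using assms by (intro compact_imp_bounded compact_continuous_image) (auto intro: continuous_on_subset)
  then obtain B where "\<And>x. x \<in> K \<Longrightarrow> norm (f x) \<le> B"
    by (auto simp: bounded_iff)
  \<comment> \<open>If \<open>K\<close> is empty, \<open>B\<close> may be negative, while the value
    0 off \<open>K\<close> still has to be bounded.\<close>
  then have "norm (f x) \<le> max B 0" for x
    using assms(3) by (cases "x \<in> K") (force simp: le_max_iff_disj)+
  then show ?thesis using that by blast
qed

text \<open>Needed, together with its counterpart for gradients of test functions, to split
  integrals of differences: the integral of a non-integrable function is 0 by convention, so
  linearity requires integrability.\<close>

lemma integrable_test_fun_mult:
  fixes g :: "plane \<Rightarrow> 'b::euclidean_space"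
  assumes "open \<Omega>" "test_fun \<Omega> \<phi>" and g: "locally_integrable \<Omega> g"
  shows "integrable (lebesgue_on \<Omega>) (\<lambda>x. \<phi> x *\<^sub>R g x)"
proof -
  define K where "K = closure {x. \<phi> x \<noteq> 0}"
  have K: "compact K" "K \<subseteq> \<Omega>"
    using assms by (auto simp: test_fun_def K_def)
  have zero: "\<phi> x = 0" if "x \<notin> K" for x
    using that closure_subset[of "{x. \<phi> x \<noteq> 0}"] by (auto simp: K_def)
  have cont: "continuous_on UNIV \<phi>"
    using assms Ck.simps(1) unfolding test_fun_def by blast
  obtain B where B: "\<And>x. norm (\<phi> x) \<le> B"
    using bounded_if_compact_support[OF cont K(1) zero] by blast
  have eq: "\<phi> x *\<^sub>R g x = \<phi> x *\<^sub>R (indicator K x *\<^sub>R g x)" for x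
    using zero by (auto split: split_indicator)
  show ?thesis
  proof (rule integrable_locally_dominated[OF assms(1) g K])
    have "(\<lambda>x. indicator K x *\<^sub>R g x) \<in> borel_measurable lebesgue"
      using g K by (auto simp: locally_integrable_def set_integrable_def)
    then show "(\<lambda>x. \<phi> x *\<^sub>R g x) \<in> borel_measurable lebesgue"
      unfolding eq by (rule borel_measurable_scaleR[OF borel_measurable_lebesgue_continuous[OF cont]])
    show "norm (\<phi> x *\<^sub>R g x) \<le> B * norm (indicator K x *\<^sub>R g x)" for x
      unfolding eq norm_scaleR[of "\<phi> x"] using B[of x] by (intro mult_right_mono) auto
  qed
qed

lemma integrable_mult_grad_test_fun:
  assumes "open \<Omega>" "test_fun \<Omega> \<phi>" and f: "locally_integrable \<Omega> f"
  shows "integrable (lebesgue_on \<Omega>) (\<lambda>x. f x *\<^sub>R grad \<phi> x)"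
proof -
  define K where "K = closure {x. \<phi> x \<noteq> 0}"
  have K: "compact K" "K \<subseteq> \<Omega>"
    using assms by (auto simp: test_fun_def K_def)
  have zero: "\<phi> x = 0" if "x \<notin> K" for x
    using that closure_subset[of "{x. \<phi> x \<noteq> 0}"] by (auto simp: K_def)
  \<comment> \<open>The complement of \<open>K\<close> is open and \<open>\<phi>\<close> is zero on
    it, so the derivative vanishes there too.\<close>
  have grad_zero: "grad \<phi> x = 0" if "x \<notin> K" for x
  proof -
    have "((\<lambda>_. 0) has_derivative (\<lambda>_. 0)) (at x)" by simp
    moreover have "open (- K)" by (simp add: K_def open_Compl)
    ultimately have "(\<phi> has_derivative (\<lambda>_. 0)) (at x)"
      by (rule has_derivative_transform_within_open) (use that zero in auto)
    from frechet_derivative_at[OF this, symmetric] show ?thesis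
      by (simp add: grad_def vec_eq_iff)
  qed
  have cont: "continuous_on UNIV (grad \<phi>)"
  proof -
    have "Ck (Suc 0) \<phi>" using assms unfolding test_fun_def by blast
    then show ?thesis
      unfolding grad_def by (auto intro!: continuous_on_vec_lambda)
  qed
  obtain B where B: "\<And>x. norm (grad \<phi> x) \<le> B"
    using bounded_if_compact_support[OF cont K(1) grad_zero] by blast
  have eq: "f x *\<^sub>R grad \<phi> x = (indicator K x *\<^sub>R f x) *\<^sub>R grad \<phi> x" for x
    using grad_zero by (auto split: split_indicator)
  show ?thesis
  proof (rule integrable_locally_dominated[OF assms(1) f K])
    have "(\<lambda>x. indicator K x *\<^sub>R f x) \<in> borel_measurable lebesgue"
      using f K by (auto simp: locally_integrable_def set_integrable_def)
    then show "(\<lambda>x. f x *\<^sub>R grad \<phi> x) \<in> borel_measurable lebesgue"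
      unfolding eq by (rule borel_measurable_scaleR) (intro borel_measurable_lebesgue_continuous cont)
    show "norm (f x *\<^sub>R grad \<phi> x) \<le> B * norm (indicator K x *\<^sub>R f x)" for x
      unfolding eq norm_scaleR[of "indicator K x *\<^sub>R f x"] mult.commute[of B] real_norm_def[symmetric]
      using B[of x] by (intro mult_left_mono) auto
  qed
qed

lemma has_weak_grad_diff:
  assumes "open \<Omega>" "has_weak_grad \<Omega> f g" "has_weak_grad \<Omega> f' g'"
  shows "has_weak_grad \<Omega> (\<lambda>x. f x - f' x) (\<lambda>x. g x - g' x)"
  unfolding has_weak_grad_def
proof (intro conjI allI impI)
  show "locally_integrable \<Omega> (\<lambda>x. f x - f' x)" "locally_integrable \<Omega> (\<lambda>x. g x - g' x)"
    using assms by (auto simp: has_weak_grad_def intro: locally_integrable_diff)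
  fix \<phi> assume "test_fun \<Omega> \<phi>"
  with assms show "(LINT x|lebesgue_on \<Omega>. (f x - f' x) *\<^sub>R grad \<phi> x) =
      - (LINT x|lebesgue_on \<Omega>. \<phi> x *\<^sub>R (g x - g' x))"
    by (simp add: has_weak_grad_def scaleR_diff_left scaleR_diff_right
        integrable_test_fun_mult integrable_mult_grad_test_fun)
qed

text \<open>The difference of the two gradients is a weak gradient of the zero function, so its
  integrals against test functions vanish and \<open>du_Bois_Reymond\<close> applies.\<close>

lemma has_weak_grad_unique:
  assumes "open \<Omega>" "has_weak_grad \<Omega> f g" "has_weak_grad \<Omega> f g'"
  shows "AE x in lebesgue_on \<Omega>. g x = g' x"
proof -
  have "AE x in lebesgue_on \<Omega>. g x - g' x = 0"
  proof (rule du_Bois_Reymond[OF \<open>open \<Omega>\<close>])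
    have *: "has_weak_grad \<Omega> (\<lambda>x. 0) (\<lambda>x. g x - g' x)"
      using has_weak_grad_diff[OF assms] by simp
    then show "locally_integrable \<Omega> (\<lambda>x. g x - g' x)"
      by (simp add: has_weak_grad_def)
    show "(LINT x|lebesgue_on \<Omega>. \<phi> x *\<^sub>R (g x - g' x)) = 0" if "test_fun \<Omega> \<phi>" for \<phi>
      using * that by (simp add: has_weak_grad_def)
  qed
  then show ?thesis by simp
qed

text \<open>Lebesgue measure is complete, so measurability survives changes on null sets; extension
  by zero transfers this to \<open>S\<close>. It serves to make an arbitrarily chosen weak gradient
  measurable.\<close>

lemma borel_measurable_lebesgue_on_AE:
  fixes f :: "'a::euclidean_space \<Rightarrow> 'b::euclidean_space"
  assumes S: "S \<in> sets lebesgue" and f: "f \<in> borel_measurable (lebesgue_on S)"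
    and ae: "AE x in lebesgue_on S. f x = g x"
  shows "g \<in> borel_measurable (lebesgue_on S)"
proof -
  have *: "S \<inter> space lebesgue \<in> sets lebesgue" using S by simp
  have "(\<lambda>x. indicator S x *\<^sub>R g x) \<in> borel_measurable lebesgue"
  proof (rule borel_measurable_AE)
    show "(\<lambda>x. indicator S x *\<^sub>R f x) \<in> borel_measurable lebesgue"
      using f borel_measurable_restrict_space_iff[OF *] by blast
    show "AE x in lebesgue. indicator S x *\<^sub>R f x = indicator S x *\<^sub>R g x"
      using ae unfolding AE_restrict_space_iff[OF *]
      by eventually_elim (auto split: split_indicator)
  qed
  then show ?thesis using borel_measurable_restrict_space_iff[OF *] by blast
qed

section \<open>Square integrable functions\<close>

lemma L2_norm_nonneg: "0 \<le> L2_norm \<Omega> f"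
  by (simp add: L2_norm_def)

lemma L2_norm_sq: "(L2_norm \<Omega> f)\<^sup>2 = (LINT x|lebesgue_on \<Omega>. (norm (f x))\<^sup>2)"
  by (simp add: L2_norm_def)

lemma L2_dominated:
  fixes f :: "plane \<Rightarrow> 'b::euclidean_space" and h :: "plane \<Rightarrow> 'c::euclidean_space"
  assumes h: "h \<in> borel_measurable (lebesgue_on \<Omega>)" and f: "f \<in> L2 \<Omega>" and "0 \<le> B"
    and le: "AE x in lebesgue_on \<Omega>. norm (h x) \<le> B * norm (f x)"
  shows "h \<in> L2 \<Omega>" and "L2_norm \<Omega> h \<le> B * L2_norm \<Omega> f"
proof -
  have sq: "AE x in lebesgue_on \<Omega>. (norm (h x))\<^sup>2 \<le> B\<^sup>2 * (norm (f x))\<^sup>2"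
    using le by eventually_elim (metis norm_ge_zero power_mono power_mult_distrib)
  have int_f: "integrable (lebesgue_on \<Omega>) (\<lambda>x. B\<^sup>2 * (norm (f x))\<^sup>2)"
    using f by (simp add: L2_def)
  have int_h: "integrable (lebesgue_on \<Omega>) (\<lambda>x. (norm (h x))\<^sup>2)"
  proof (rule Bochner_Integration.integrable_bound[OF int_f])
    show "AE x in lebesgue_on \<Omega>. norm ((norm (h x))\<^sup>2) \<le> norm (B\<^sup>2 * (norm (f x))\<^sup>2)"
      using sq by eventually_elim simp
  qed (use h in measurable)
  then show "h \<in> L2 \<Omega>" using h by (simp add: L2_def)
  have "(L2_norm \<Omega> h)\<^sup>2 \<le> (B * L2_norm \<Omega> f)\<^sup>2"
    using integral_mono_AE[OF int_h int_f sq] by (simp add: L2_norm_sq power_mult_distrib)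
  then show "L2_norm \<Omega> h \<le> B * L2_norm \<Omega> f"
    using \<open>0 \<le> B\<close> by (simp add: power2_le_iff_abs_le L2_norm_nonneg)
qed

lemma L2_AE_cong:
  fixes f :: "plane \<Rightarrow> 'b::euclidean_space"
  assumes "open \<Omega>" "f \<in> L2 \<Omega>" "AE x in lebesgue_on \<Omega>. f x = g x"
  shows "g \<in> L2 \<Omega>"
proof (rule L2_dominated)
  show "g \<in> borel_measurable (lebesgue_on \<Omega>)"
    using assms(1,2) by (intro borel_measurable_lebesgue_on_AE[OF _ _ assms(3)]) (simp_all add: L2_def)
  show "AE x in lebesgue_on \<Omega>. norm (g x) \<le> 1 * norm (f x)"
    using assms(3) by eventually_elim simp
qed (use assms in auto)

lemma L2_add:
  fixes f g :: "plane \<Rightarrow> 'b::euclidean_space"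
  assumes "f \<in> L2 \<Omega>" "g \<in> L2 \<Omega>"
  shows "(\<lambda>x. f x + g x) \<in> L2 \<Omega>"
proof -
  have [measurable]: "f \<in> borel_measurable (lebesgue_on \<Omega>)" "g \<in> borel_measurable (lebesgue_on \<Omega>)"
    using assms by (auto simp: L2_def)
  have "integrable (lebesgue_on \<Omega>) (\<lambda>x. 2 * (norm (f x))\<^sup>2 + 2 * (norm (g x))\<^sup>2)"
    using assms by (simp add: L2_def)
  then have "integrable (lebesgue_on \<Omega>) (\<lambda>x. (norm (f x + g x))\<^sup>2)"
  proof (rule Bochner_Integration.integrable_bound)
    have "(norm (f x + g x))\<^sup>2 \<le> 2 * (norm (f x))\<^sup>2 + 2 * (norm (g x))\<^sup>2" for x
    proof -
      have "(norm (f x + g x))\<^sup>2 \<le> (norm (f x) + norm (g x))\<^sup>2"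
        by (intro power_mono norm_triangle_ineq) simp
      also have "\<dots> \<le> 2 * (norm (f x))\<^sup>2 + 2 * (norm (g x))\<^sup>2"
        using sum_squares_bound[of "norm (f x)" "norm (g x)"] by (simp add: power2_sum)
      finally show ?thesis .
    qed
    then show "AE x in lebesgue_on \<Omega>. norm ((norm (f x + g x))\<^sup>2) \<le> norm (2 * (norm (f x))\<^sup>2 + 2 * (norm (g x))\<^sup>2)"
      by simp
  qed measurable
  then show ?thesis by (simp add: L2_def)
qed

lemma L2_scale:
  fixes f :: "plane \<Rightarrow> 'b::euclidean_space"
  shows "f \<in> L2 \<Omega> \<Longrightarrow> (\<lambda>x. c *\<^sub>R f x) \<in> L2 \<Omega>"
  by (auto simp: L2_def power_mult_distrib intro!: borel_measurable_scaleR)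

lemma L2_integrable_inner:
  fixes f g :: "plane \<Rightarrow> 'b::euclidean_space"
  assumes "f \<in> L2 \<Omega>" "g \<in> L2 \<Omega>"
  shows "integrable (lebesgue_on \<Omega>) (\<lambda>x. f x \<bullet> g x)"
proof -
  have [measurable]: "f \<in> borel_measurable (lebesgue_on \<Omega>)" "g \<in> borel_measurable (lebesgue_on \<Omega>)"
    using assms by (auto simp: L2_def)
  have "integrable (lebesgue_on \<Omega>) (\<lambda>x. (norm (f x))\<^sup>2 + (norm (g x))\<^sup>2)"
    using assms by (simp add: L2_def)
  then show ?thesis
  proof (rule Bochner_Integration.integrable_bound)
    have "\<bar>f x \<bullet> g x\<bar> \<le> (norm (f x))\<^sup>2 + (norm (g x))\<^sup>2" for x
      using Cauchy_Schwarz_ineq2[of "f x" "g x"] sum_squares_bound[of "norm (f x)" "norm (g x)"]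
        mult_nonneg_nonneg[OF norm_ge_zero[of "f x"] norm_ge_zero[of "g x"]]
      by linarith
    then show "AE x in lebesgue_on \<Omega>. norm (f x \<bullet> g x) \<le> norm ((norm (f x))\<^sup>2 + (norm (g x))\<^sup>2)"
      by simp
  qed measurable
qed

text \<open>The squared norm of \<open>f - t g\<close> is a nonnegative quadratic in
  \<open>t\<close>; evaluating it at its minimiser \<open>?c / ?b\<close> gives the claim. If
  \<open>?b = 0\<close> it is affine in \<open>t\<close>, which forces
  \<open>?c = 0\<close>.\<close>

lemma L2_Cauchy_Schwarz:
  fixes f g :: "plane \<Rightarrow> 'b::euclidean_space"
  assumes f: "f \<in> L2 \<Omega>" and g: "g \<in> L2 \<Omega>"
  shows "\<bar>LINT x|lebesgue_on \<Omega>. f x \<bullet> g x\<bar> \<le> L2_norm \<Omega> f * L2_norm \<Omega> g"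
proof -
  let ?a = "(L2_norm \<Omega> f)\<^sup>2" and ?b = "(L2_norm \<Omega> g)\<^sup>2" and ?c = "LINT x|lebesgue_on \<Omega>. f x \<bullet> g x"
  have quad: "0 \<le> ?a - 2 * t * ?c + t\<^sup>2 * ?b" for t
  proof -
    have "0 \<le> (LINT x|lebesgue_on \<Omega>. (norm (f x - t *\<^sub>R g x))\<^sup>2)" by simp
    also have "(\<lambda>x. (norm (f x - t *\<^sub>R g x))\<^sup>2) = (\<lambda>x. (norm (f x))\<^sup>2 - 2 * t * (f x \<bullet> g x) + t\<^sup>2 * (norm (g x))\<^sup>2)"
      unfolding power2_norm_eq_inner by (simp add: fun_eq_iff inner_simps inner_commute power2_eq_square algebra_simps)
    also have "(LINT x|lebesgue_on \<Omega>. (norm (f x))\<^sup>2 - 2 * t * (f x \<bullet> g x) + t\<^sup>2 * (norm (g x))\<^sup>2)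
        = ?a - 2 * t * ?c + t\<^sup>2 * ?b"
      using f g L2_integrable_inner[OF f g] by (simp add: L2_norm_sq L2_def)
    finally show ?thesis .
  qed
  have complete_square: "(a - 2 * (c / b) * c + (c / b)\<^sup>2 * b) * b = a * b - c\<^sup>2" if "b \<noteq> 0" for a b c :: real
    using that by (simp add: field_simps power2_eq_square)
  have "?c\<^sup>2 \<le> ?a * ?b"
  proof (cases "?b = 0")
    case True
    have "?c = 0"
    proof (rule ccontr)
      assume "?c \<noteq> 0"
      \<comment> \<open>At this \<open>t\<close> the affine function takes the value
        \<open>- 1\<close>.\<close>
      then show False using quad[of "(?a + 1) / (2 * ?c)"] True by (simp add: field_simps)
    qed
    with True show ?thesis by simp
  next
    case False
    have "0 \<le> (?a - 2 * (?c / ?b) * ?c + (?c / ?b)\<^sup>2 * ?b) * ?b"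
      using quad[of "?c / ?b"] by simp
    also have "\<dots> = ?a * ?b - ?c\<^sup>2"
      using complete_square[OF False] .
    finally show ?thesis by simp
  qed
  then have "?c\<^sup>2 \<le> (L2_norm \<Omega> f * L2_norm \<Omega> g)\<^sup>2"
    by (simp add: power_mult_distrib)
  then show ?thesis
    by (simp add: power2_le_iff_abs_le L2_norm_nonneg)
qed

text \<open>The essential supremum is real or minus infinity. In the latter case the pointwise bound
  is contradictory, so the conversion to a real loses nothing.\<close>

lemma Linf_AE_bound:
  assumes "f \<in> Linf \<Omega>"
  shows "AE x in lebesgue_on \<Omega>. norm (f x) \<le> Linf_norm \<Omega> f"
  using esssup_AE[of "\<lambda>x. ereal (norm (f x))" "lebesgue_on \<Omega>"]
proof eventually_elim
  case (elim x)
  then show ?case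
    using assms unfolding Linf_norm_def Linf_def
    by (cases "esssup (lebesgue_on \<Omega>) (\<lambda>x. ereal (norm (f x)))") auto
qed

lemma L2_Linf_scale:
  fixes f :: "plane \<Rightarrow> 'b::euclidean_space"
  assumes c: "c \<in> Linf \<Omega>" and f: "f \<in> L2 \<Omega>"
  shows "(\<lambda>x. c x *\<^sub>R f x) \<in> L2 \<Omega>"
    and "0 \<le> B \<Longrightarrow> Linf_norm \<Omega> c \<le> B \<Longrightarrow> L2_norm \<Omega> (\<lambda>x. c x *\<^sub>R f x) \<le> B * L2_norm \<Omega> f"
proof -
  have meas: "(\<lambda>x. c x *\<^sub>R f x) \<in> borel_measurable (lebesgue_on \<Omega>)"
    using c f by (auto simp: Linf_def L2_def intro!: borel_measurable_scaleR)
  have le: "AE x in lebesgue_on \<Omega>. norm (c x *\<^sub>R f x) \<le> B * norm (f x)" if "Linf_norm \<Omega> c \<le> B" for B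
    using Linf_AE_bound[OF c]
    by eventually_elim (use that in \<open>auto intro!: mult_right_mono\<close>)
  show "(\<lambda>x. c x *\<^sub>R f x) \<in> L2 \<Omega>"
    \<comment> \<open>The maximum with 0 supplies the nonnegative factor that
      \<open>L2_dominated\<close> asks for.\<close>
    using L2_dominated(1)[OF meas f _ le[of "max 0 (Linf_norm \<Omega> c)"]] by simp
  show "L2_norm \<Omega> (\<lambda>x. c x *\<^sub>R f x) \<le> B * L2_norm \<Omega> f" if "0 \<le> B" "Linf_norm \<Omega> c \<le> B"
    using L2_dominated(2)[OF meas f that(1) le[OF that(2)]] .
qed

section \<open>Weak gradients of functions in \<open>H1\<close>\<close>

lemma has_weak_grad_weak_grad:
  assumes "f \<in> H1 \<Omega>"
  shows "has_weak_grad \<Omega> f (weak_grad \<Omega> f)"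
proof -
  have "\<exists>g. has_weak_grad \<Omega> f g" using assms by (auto simp: H1_def)
  then show ?thesis unfolding weak_grad_def by (rule someI_ex)
qed

text \<open>The gradient selected by \<open>weak_grad\<close> need not be the square integrable one
  provided by \<open>H1\<close>, but by uniqueness the two agree almost everywhere.\<close>

lemma weak_grad_in_L2:
  assumes "open \<Omega>" "f \<in> H1 \<Omega>"
  shows "weak_grad \<Omega> f \<in> L2 \<Omega>"
proof -
  obtain g where g: "g \<in> L2 \<Omega>" "has_weak_grad \<Omega> f g"
    using assms by (auto simp: H1_def)
  then show ?thesis
    using L2_AE_cong[OF assms(1)] has_weak_grad_unique[OF assms(1)] has_weak_grad_weak_grad[OF assms(2)]
    by blast
qed

text \<open>The gradients of the three functions are chosen independently, so linearity comes from
  uniqueness and holds only almost everywhere.\<close>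

lemma weak_grad_diff:
  assumes "open \<Omega>" "f \<in> H1 \<Omega>" "g \<in> H1 \<Omega>" "(\<lambda>x. f x - g x) \<in> H1 \<Omega>"
  shows "AE x in lebesgue_on \<Omega>. weak_grad \<Omega> (\<lambda>x. f x - g x) x = weak_grad \<Omega> f x - weak_grad \<Omega> g x"
  by (rule has_weak_grad_unique[OF assms(1) has_weak_grad_weak_grad[OF assms(4)]])
    (intro has_weak_grad_diff has_weak_grad_weak_grad assms)

lemma H10_imp_H1: "f \<in> H10 \<Omega> \<Longrightarrow> f \<in> H1 \<Omega>"
  by (simp add: H10_def)

lemma H1_imp_L2: "f \<in> H1 \<Omega> \<Longrightarrow> f \<in> L2 \<Omega>"
  by (simp add: H1_def)

section \<open>Weighted norms and the error functional\<close>

lemma eps_norm3_nonneg: "0 \<le> eps_norm3 \<Omega> \<epsilon> v"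
  by (cases v) simp

lemma eps_norm_le_eps_norm3:
  "eps_norm \<Omega> \<epsilon> v1 \<le> eps_norm3 \<Omega> \<epsilon> (v1, v2, v3)"
  "eps_norm \<Omega> \<epsilon> v2 \<le> eps_norm3 \<Omega> \<epsilon> (v1, v2, v3)"
  "eps_norm \<Omega> \<epsilon> v3 \<le> eps_norm3 \<Omega> \<epsilon> (v1, v2, v3)"
  by (auto intro!: real_le_rsqrt)

lemma L2_norm_le_eps_norm: "0 \<le> \<epsilon> \<Longrightarrow> L2_norm \<Omega> v \<le> eps_norm \<Omega> \<epsilon> v"
  unfolding eps_norm_def by (intro real_le_rsqrt) simp

lemma L2_norm_weak_grad_le_eps_norm:
  "0 < \<epsilon> \<Longrightarrow> L2_norm \<Omega> (weak_grad \<Omega> v) \<le> eps_norm \<Omega> \<epsilon> v / sqrt \<epsilon>"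
  unfolding eps_norm_def real_sqrt_divide[symmetric] by (intro real_le_rsqrt) (simp add: field_simps)

text \<open>Each quotient for \<open>F\<close> is bounded separately by the supremum for
  \<open>G\<close> plus \<open>K\<close>. The bound \<open>M\<close> ensures that the real supremum
  defining the dual norm of \<open>G\<close> is a genuine upper bound.\<close>

lemma dual_norm_perturbation:
  assumes nonempty: "{v \<in> H10_3 \<Omega>. \<not> zero_ae \<Omega> v} \<noteq> {}"
    and "0 \<le> M" and bounded: "\<And>v. v \<in> H10_3 \<Omega> \<Longrightarrow> \<bar>G v\<bar> \<le> M * eps_norm3 \<Omega> \<epsilon> v"
    and "0 \<le> K" and le: "\<And>v. v \<in> H10_3 \<Omega> \<Longrightarrow> \<bar>F v\<bar> \<le> \<bar>G v\<bar> + K * eps_norm3 \<Omega> \<epsilon> v"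
  shows "dual_norm \<Omega> \<epsilon> F \<le> dual_norm \<Omega> \<epsilon> G + K"
  unfolding dual_norm_def
proof (rule cSUP_least[OF nonempty])
  \<comment> \<open>Positivity of the weighted norm is not established. Where it is 0, the quotient
    is 0 by convention, and the bound holds as \<open>b\<close> is nonnegative.\<close>
  have quotient: "a / E \<le> b" if "0 \<le> E" "0 \<le> b" "a \<le> b * E" for a b E :: real
    using that by (cases "E = 0") (auto simp: pos_divide_le_eq)
  fix v assume v: "v \<in> {v \<in> H10_3 \<Omega>. \<not> zero_ae \<Omega> v}"
  let ?E = "eps_norm3 \<Omega> \<epsilon> v"
  have "\<bar>F v\<bar> / ?E \<le> (\<bar>G v\<bar> + K * ?E) / ?E"
    using v le eps_norm3_nonneg by (intro divide_right_mono) auto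
  also have "\<dots> \<le> \<bar>G v\<bar> / ?E + K"
    using \<open>0 \<le> K\<close> by (cases "?E = 0") (auto simp: add_divide_distrib)
  also have "\<bar>G v\<bar> / ?E \<le> (SUP v\<in>{v \<in> H10_3 \<Omega>. \<not> zero_ae \<Omega> v}. \<bar>G v\<bar> / eps_norm3 \<Omega> \<epsilon> v)"
  proof (rule cSUP_upper[OF v], rule bdd_aboveI2)
    show "\<bar>G w\<bar> / eps_norm3 \<Omega> \<epsilon> w \<le> M" if "w \<in> {v \<in> H10_3 \<Omega>. \<not> zero_ae \<Omega> v}" for w
      using that by (intro quotient eps_norm3_nonneg \<open>0 \<le> M\<close> bounded) auto
  qed
  finally show "\<bar>F v\<bar> / ?E \<le> (SUP v\<in>{v \<in> H10_3 \<Omega>. \<not> zero_ae \<Omega> v}. \<bar>G v\<bar> / eps_norm3 \<Omega> \<epsilon> v) + K"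
    by simp
qed

text \<open>Cauchy-Schwarz is applied to each term. A gradient costs a factor
  \<open>1 / sqrt \<epsilon>\<close> in the weighted norm; the value of \<open>v3\<close> costs at
  most that, because \<open>\<epsilon> \<le> 1\<close>. Both \<open>DF(u) e\<close> and the
  quadratic remainder have this form.\<close>

lemma L2_functional_bound:
  fixes w1 w2 w3 :: "plane \<Rightarrow> plane" and z :: scalar_fun
  assumes "open \<Omega>" and \<epsilon>: "0 < \<epsilon>" "\<epsilon> \<le> 1"
    and w: "w1 \<in> L2 \<Omega>" "w2 \<in> L2 \<Omega>" "w3 \<in> L2 \<Omega>" "z \<in> L2 \<Omega>"
    and v: "(v1, v2, v3) \<in> H10_3 \<Omega>"
  shows "\<bar>LINT x|lebesgue_on \<Omega>. w1 x \<bullet> weak_grad \<Omega> v1 x + w2 x \<bullet> weak_grad \<Omega> v2 x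
        + w3 x \<bullet> weak_grad \<Omega> v3 x + z x * v3 x\<bar>
     \<le> (L2_norm \<Omega> w1 + L2_norm \<Omega> w2 + L2_norm \<Omega> w3 + L2_norm \<Omega> z) / sqrt \<epsilon> * eps_norm3 \<Omega> \<epsilon> (v1, v2, v3)"
proof -
  let ?E = "eps_norm3 \<Omega> \<epsilon> (v1, v2, v3)" and ?D = "weak_grad \<Omega>"
  have H1: "v1 \<in> H1 \<Omega>" "v2 \<in> H1 \<Omega>" "v3 \<in> H1 \<Omega>"
    using v by (auto intro: H10_imp_H1)
  note D_L2 = weak_grad_in_L2[OF \<open>open \<Omega>\<close>]
  have grad: "\<bar>LINT x|lebesgue_on \<Omega>. w x \<bullet> ?D u x\<bar> \<le> L2_norm \<Omega> w * (?E / sqrt \<epsilon>)"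
    if "w \<in> L2 \<Omega>" "u \<in> H1 \<Omega>" "eps_norm \<Omega> \<epsilon> u \<le> ?E" for w u
  proof -
    have "L2_norm \<Omega> (?D u) \<le> ?E / sqrt \<epsilon>"
      using L2_norm_weak_grad_le_eps_norm[OF \<epsilon>(1), of \<Omega> u] that(3) \<epsilon>
      by (meson divide_right_mono order_trans real_sqrt_ge_zero less_imp_le)
    then show ?thesis
      using L2_Cauchy_Schwarz[OF that(1) D_L2[OF that(2)]] L2_norm_nonneg[of \<Omega> w]
      by (meson mult_left_mono order_trans)
  qed
  have "sqrt \<epsilon> \<le> 1" "0 < sqrt \<epsilon>" using \<epsilon> by auto
  then have "?E \<le> ?E / sqrt \<epsilon>"
    using eps_norm3_nonneg[of \<Omega> \<epsilon> "(v1, v2, v3)"] by (simp add: pos_le_divide_eq mult_left_le del: eps_norm3.simps)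
  then have "L2_norm \<Omega> v3 \<le> ?E / sqrt \<epsilon>"
    using L2_norm_le_eps_norm[of \<epsilon> \<Omega> v3] eps_norm_le_eps_norm3(3)[of \<Omega> \<epsilon> v3 v1 v2] \<epsilon> by linarith
  then have val: "\<bar>LINT x|lebesgue_on \<Omega>. z x \<bullet> v3 x\<bar> \<le> L2_norm \<Omega> z * (?E / sqrt \<epsilon>)"
    using L2_Cauchy_Schwarz[OF w(4) H1_imp_L2[OF H1(3)]] L2_norm_nonneg[of \<Omega> z]
    by (meson mult_left_mono order_trans)
  have "(LINT x|lebesgue_on \<Omega>. w1 x \<bullet> ?D v1 x + w2 x \<bullet> ?D v2 x + w3 x \<bullet> ?D v3 x + z x \<bullet> v3 x)
      = (LINT x|lebesgue_on \<Omega>. w1 x \<bullet> ?D v1 x) + (LINT x|lebesgue_on \<Omega>. w2 x \<bullet> ?D v2 x)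
      + (LINT x|lebesgue_on \<Omega>. w3 x \<bullet> ?D v3 x) + (LINT x|lebesgue_on \<Omega>. z x \<bullet> v3 x)"
    using L2_integrable_inner[OF w(1) D_L2[OF H1(1)]] L2_integrable_inner[OF w(2) D_L2[OF H1(2)]]
      L2_integrable_inner[OF w(3) D_L2[OF H1(3)]] L2_integrable_inner[OF w(4) H1_imp_L2[OF H1(3)]]
    by simp
  moreover have "\<bar>a + b + c + d\<bar> \<le> (A + B + C + D) / s * E"
    if "\<bar>a\<bar> \<le> A * (E / s)" "\<bar>b\<bar> \<le> B * (E / s)" "\<bar>c\<bar> \<le> C * (E / s)" "\<bar>d\<bar> \<le> D * (E / s)"
    for a b c d A B C D E s :: real
  proof -
    have "(A + B + C + D) / s * E = A * (E / s) + B * (E / s) + C * (E / s) + D * (E / s)"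
      by (simp add: field_simps add_divide_distrib)
    with that show ?thesis by linarith
  qed
  ultimately show ?thesis
    using grad[OF w(1) H1(1) eps_norm_le_eps_norm3(1)] grad[OF w(2) H1(2) eps_norm_le_eps_norm3(2)]
      grad[OF w(3) H1(3) eps_norm_le_eps_norm3(3)] val
    by (simp only: inner_real_def)
qed

text \<open>Collecting the terms by the component of the test triple gives the form of
  \<open>L2_functional_bound\<close>. Each product of a coefficient with a gradient is square
  integrable because the coefficient is bounded.\<close>

lemma pnp_DF_bounded:
  assumes "open \<Omega>" "0 < \<epsilon>" "\<epsilon> \<le> 1" "p \<in> Linf \<Omega>" "n \<in> Linf \<Omega>" "\<psi> \<in> H1 \<Omega>"
    and H1: "\<phi>1 \<in> H1 \<Omega>" "\<phi>2 \<in> H1 \<Omega>" "\<phi>3 \<in> H1 \<Omega>" and Linf: "\<phi>1 \<in> Linf \<Omega>" "\<phi>2 \<in> Linf \<Omega>"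
  obtains M where "0 \<le> M"
    and "\<And>v. v \<in> H10_3 \<Omega> \<Longrightarrow> \<bar>pnp_DF \<Omega> \<epsilon> (p, n, \<psi>) (\<phi>1, \<phi>2, \<phi>3) v\<bar> \<le> M * eps_norm3 \<Omega> \<epsilon> v"
proof -
  let ?D = "weak_grad \<Omega>"
  note D_L2 = weak_grad_in_L2[OF \<open>open \<Omega>\<close>]
  define w1 where "w1 = (\<lambda>x. ?D \<phi>1 x + p x *\<^sub>R ?D \<phi>3 x + \<phi>1 x *\<^sub>R ?D \<psi> x)"
  \<comment> \<open>Minus signs are written as scalings so that closure of \<open>L2\<close> under
    sums and scalings suffices.\<close>
  define w2 where "w2 = (\<lambda>x. ?D \<phi>2 x + (- 1) *\<^sub>R (n x *\<^sub>R ?D \<phi>3 x) + (- 1) *\<^sub>R (\<phi>2 x *\<^sub>R ?D \<psi> x))"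
  define w3 where "w3 = (\<lambda>x. \<epsilon> *\<^sub>R ?D \<phi>3 x)"
  define z where "z = (\<lambda>x. (- 1) *\<^sub>R \<phi>1 x + \<phi>2 x)"
  have w: "w1 \<in> L2 \<Omega>" "w2 \<in> L2 \<Omega>" "w3 \<in> L2 \<Omega>" "z \<in> L2 \<Omega>"
    unfolding w1_def w2_def w3_def z_def
    by (intro L2_add L2_scale L2_Linf_scale(1) D_L2 H1_imp_L2 assms)+
  show thesis
  proof
    fix v assume v: "v \<in> H10_3 \<Omega>"
    obtain v1 v2 v3 where v_eq: "v = (v1, v2, v3)" by (cases v)
    have "pnp_DF \<Omega> \<epsilon> (p, n, \<psi>) (\<phi>1, \<phi>2, \<phi>3) v =
        (LINT x|lebesgue_on \<Omega>. w1 x \<bullet> ?D v1 x + w2 x \<bullet> ?D v2 x + w3 x \<bullet> ?D v3 x + z x * v3 x)"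
      unfolding v_eq pnp_DF.simps Let_def w1_def w2_def w3_def z_def
      by (intro Bochner_Integration.integral_cong refl) (simp add: inner_simps algebra_simps)
    then show "\<bar>pnp_DF \<Omega> \<epsilon> (p, n, \<psi>) (\<phi>1, \<phi>2, \<phi>3) v\<bar>
        \<le> (L2_norm \<Omega> w1 + L2_norm \<Omega> w2 + L2_norm \<Omega> w3 + L2_norm \<Omega> z) / sqrt \<epsilon> * eps_norm3 \<Omega> \<epsilon> v"
      using L2_functional_bound[OF assms(1-3) w] v v_eq by simp
  qed (use \<open>0 < \<epsilon>\<close> in \<open>simp add: L2_norm_nonneg\<close>)
qed

definition pnp_remainder :: "plane set \<Rightarrow> triple_fun \<Rightarrow> triple_fun \<Rightarrow> real" where
  "pnp_remainder \<Omega> = (\<lambda>(e1, e2, e3) (v1, v2, v3). LINT x|lebesgue_on \<Omega>.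
     e1 x * (weak_grad \<Omega> e3 x \<bullet> weak_grad \<Omega> v1 x) - e2 x * (weak_grad \<Omega> e3 x \<bullet> weak_grad \<Omega> v2 x))"

text \<open>One factor \<open>1 / sqrt \<epsilon>\<close> comes from the gradient of
  \<open>e3\<close>, a second from the gradients of the test functions, and the 2 from the two
  terms.\<close>

lemma pnp_remainder_bound:
  assumes "open \<Omega>" and \<epsilon>: "0 < \<epsilon>" "\<epsilon> \<le> 1"
    and e: "e1 \<in> Linf \<Omega>" "e2 \<in> Linf \<Omega>" "e3 \<in> H1 \<Omega>"
    and \<delta>: "0 \<le> \<delta>" "Linf_norm \<Omega> e1 \<le> \<delta>" "Linf_norm \<Omega> e2 \<le> \<delta>"
    and v: "v \<in> H10_3 \<Omega>"
  shows "\<bar>pnp_remainder \<Omega> (e1, e2, e3) v\<bar>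
    \<le> 2 * \<delta> / \<epsilon> * eps_norm3 \<Omega> \<epsilon> (e1, e2, e3) * eps_norm3 \<Omega> \<epsilon> v"
proof -
  let ?D = "weak_grad \<Omega>" and ?E = "eps_norm3 \<Omega> \<epsilon> (e1, e2, e3)"
  have De3: "?D e3 \<in> L2 \<Omega>" using weak_grad_in_L2[OF \<open>open \<Omega>\<close> e(3)] .
  define w1 where "w1 = (\<lambda>x. e1 x *\<^sub>R ?D e3 x)"
  define w2 where "w2 = (\<lambda>x. e2 x *\<^sub>R ((- 1) *\<^sub>R ?D e3 x))"
  have w: "w1 \<in> L2 \<Omega>" "w2 \<in> L2 \<Omega>" "(\<lambda>x. 0 :: plane) \<in> L2 \<Omega>" "(\<lambda>x. 0 :: real) \<in> L2 \<Omega>"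
    unfolding w1_def w2_def by (intro L2_Linf_scale(1) L2_scale De3 e | simp add: L2_def)+
  have "L2_norm \<Omega> (?D e3) \<le> ?E / sqrt \<epsilon>"
    using L2_norm_weak_grad_le_eps_norm[OF \<epsilon>(1), of \<Omega> e3] eps_norm_le_eps_norm3(3)[of \<Omega> \<epsilon> e3 e1 e2] \<epsilon>
    by (meson divide_right_mono order_trans real_sqrt_ge_zero less_imp_le)
  then have *: "\<delta> * L2_norm \<Omega> (?D e3) \<le> \<delta> * (?E / sqrt \<epsilon>)"
    using \<delta>(1) by (rule mult_left_mono)
  have w1_le: "L2_norm \<Omega> w1 \<le> \<delta> * (?E / sqrt \<epsilon>)"
    using L2_Linf_scale(2)[OF e(1) De3 \<delta>(1) \<delta>(2)] * unfolding w1_def by linarith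
  have neg: "L2_norm \<Omega> (\<lambda>x. (- 1) *\<^sub>R ?D e3 x) = L2_norm \<Omega> (?D e3)"
    by (simp add: L2_norm_def)
  have w2_le: "L2_norm \<Omega> w2 \<le> \<delta> * (?E / sqrt \<epsilon>)"
    using L2_Linf_scale(2)[OF e(2) L2_scale[OF De3, of "- 1"] \<delta>(1) \<delta>(3)] * unfolding w2_def neg by linarith
  obtain v1 v2 v3 where v_eq: "v = (v1, v2, v3)" by (cases v)
  have "pnp_remainder \<Omega> (e1, e2, e3) v =
      (LINT x|lebesgue_on \<Omega>. w1 x \<bullet> ?D v1 x + w2 x \<bullet> ?D v2 x + 0 \<bullet> ?D v3 x + 0 * v3 x)"
    unfolding v_eq pnp_remainder_def w1_def w2_def by simp
  also have "\<bar>\<dots>\<bar> \<le> (L2_norm \<Omega> w1 + L2_norm \<Omega> w2 + L2_norm \<Omega> (\<lambda>x. 0 :: plane) + L2_norm \<Omega> (\<lambda>x. 0 :: real))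
      / sqrt \<epsilon> * eps_norm3 \<Omega> \<epsilon> v"
    using L2_functional_bound[OF assms(1-3) w] v unfolding v_eq by blast
  also have "\<dots> \<le> (\<delta> * (?E / sqrt \<epsilon>) + \<delta> * (?E / sqrt \<epsilon>)) / sqrt \<epsilon> * eps_norm3 \<Omega> \<epsilon> v"
    using w1_le w2_le \<epsilon> eps_norm3_nonneg
    by (intro mult_right_mono divide_right_mono) (auto simp: L2_norm_def[of _ "\<lambda>x. 0"])
  also have "\<dots> = 2 * \<delta> / (sqrt \<epsilon> * sqrt \<epsilon>) * ?E * eps_norm3 \<Omega> \<epsilon> v"
    by (simp add: field_simps del: eps_norm3.simps real_sqrt_mult_self)
  finally show ?thesis using \<epsilon> by simp
qed

text \<open>The only nonlinear terms of \<open>pnp_F\<close> are quadratic, so its second-order Taylor expansion at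
  \<open>u\<close> is exact.\<close>

lemma pnp_F_expansion:
  assumes "open \<Omega>"
    and f: "f1 \<in> L2 \<Omega>" "f2 \<in> L2 \<Omega>" "f3 \<in> L2 \<Omega>"
    and u: "p \<in> H1 \<Omega>" "n \<in> H1 \<Omega>" "\<psi> \<in> H1 \<Omega>" "p \<in> Linf \<Omega>" "n \<in> Linf \<Omega>"
    and uh: "ph \<in> H1 \<Omega>" "nh \<in> H1 \<Omega>" "\<psi>h \<in> H1 \<Omega>"
    and e_def: "e1 = (\<lambda>x. p x - ph x)" "e2 = (\<lambda>x. n x - nh x)" "e3 = (\<lambda>x. \<psi> x - \<psi>h x)"
    and e: "e1 \<in> H1 \<Omega>" "e2 \<in> H1 \<Omega>" "e3 \<in> H1 \<Omega>" "e1 \<in> Linf \<Omega>" "e2 \<in> Linf \<Omega>"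
    and v: "v \<in> H10_3 \<Omega>"
  shows "pnp_F \<Omega> \<epsilon> (f1, f2, f3) (ph, nh, \<psi>h) v =
    pnp_F \<Omega> \<epsilon> (f1, f2, f3) (p, n, \<psi>) v - pnp_DF \<Omega> \<epsilon> (p, n, \<psi>) (e1, e2, e3) v
    + pnp_remainder \<Omega> (e1, e2, e3) v"
proof -
  let ?D = "weak_grad \<Omega>" and ?M = "lebesgue_on \<Omega>"
  obtain v1 v2 v3 where v_eq: "v = (v1, v2, v3)" by (cases v)
  then have v_H1: "v1 \<in> H1 \<Omega>" "v2 \<in> H1 \<Omega>" "v3 \<in> H1 \<Omega>"
    using v by (auto intro: H10_imp_H1)
  note L2s = f H1_imp_L2[OF u(1)] H1_imp_L2[OF u(2)] v_H1[THEN H1_imp_L2] e(1-3)[THEN H1_imp_L2]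
    u(1-3)[THEN weak_grad_in_L2[OF \<open>open \<Omega>\<close>]] e(1-3)[THEN weak_grad_in_L2[OF \<open>open \<Omega>\<close>]]
    v_H1[THEN weak_grad_in_L2[OF \<open>open \<Omega>\<close>]]
  have int_real: "integrable ?M (\<lambda>x. a x * b x)" if "a \<in> L2 \<Omega>" "b \<in> L2 \<Omega>" for a b :: scalar_fun
    using L2_integrable_inner[OF that] by simp
  have int_Linf: "integrable ?M (\<lambda>x. c x * (a x \<bullet> b x))"
    if "c \<in> Linf \<Omega>" "a \<in> L2 \<Omega>" "b \<in> L2 \<Omega>" for c and a b :: "plane \<Rightarrow> plane"
    using L2_integrable_inner[OF L2_Linf_scale(1)[OF that(1,2)] that(3)] by simp
  note ints = Bochner_Integration.integrable_add Bochner_Integration.integrable_diff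
    int_Linf u(4,5) e(4,5) int_real L2_integrable_inner L2s integrable_mult_right
  define F where "F = (\<lambda>x. ?D p x \<bullet> ?D v1 x + p x * (?D \<psi> x \<bullet> ?D v1 x)
       + ?D n x \<bullet> ?D v2 x - n x * (?D \<psi> x \<bullet> ?D v2 x)
       + \<epsilon> * (?D \<psi> x \<bullet> ?D v3 x) - p x * v3 x + n x * v3 x
       - f1 x * v1 x - f2 x * v2 x - f3 x * v3 x)"
  define DF where "DF = (\<lambda>x. ?D e1 x \<bullet> ?D v1 x + p x * (?D e3 x \<bullet> ?D v1 x) + e1 x * (?D \<psi> x \<bullet> ?D v1 x)
       + ?D e2 x \<bullet> ?D v2 x - n x * (?D e3 x \<bullet> ?D v2 x) - e2 x * (?D \<psi> x \<bullet> ?D v2 x)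
       + \<epsilon> * (?D e3 x \<bullet> ?D v3 x) - e1 x * v3 x + e2 x * v3 x)"
  define N where "N = (\<lambda>x. e1 x * (?D e3 x \<bullet> ?D v1 x) - e2 x * (?D e3 x \<bullet> ?D v2 x))"
  \<comment> \<open>These three are integrable, each term being a product of two \<open>L2\<close>
    factors, possibly with a bounded coefficient; this allows the integral to be split at the
    end.\<close>
  have int: "integrable ?M F" "integrable ?M DF" "integrable ?M N"
    unfolding F_def DF_def N_def by (intro ints)+
  have meas: "a \<in> borel_measurable ?M" if "a \<in> L2 \<Omega>" for a :: "plane \<Rightarrow> 'b::euclidean_space"
    using that by (simp add: L2_def)
  note uh_L2s = uh[THEN H1_imp_L2] uh[THEN weak_grad_in_L2[OF \<open>open \<Omega>\<close>]]
  have "AE x in ?M. ?D e1 x = ?D p x - ?D ph x \<and> ?D e2 x = ?D n x - ?D nh x \<and> ?D e3 x = ?D \<psi> x - ?D \<psi>h x"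
    using weak_grad_diff[OF \<open>open \<Omega>\<close>] u uh e unfolding e_def by auto
  then have AE: "AE x in ?M. ?D ph x \<bullet> ?D v1 x + ph x * (?D \<psi>h x \<bullet> ?D v1 x)
       + ?D nh x \<bullet> ?D v2 x - nh x * (?D \<psi>h x \<bullet> ?D v2 x)
       + \<epsilon> * (?D \<psi>h x \<bullet> ?D v3 x) - ph x * v3 x + nh x * v3 x
       - f1 x * v1 x - f2 x * v2 x - f3 x * v3 x = F x - DF x + N x"
  proof eventually_elim
    case (elim x)
    then have D: "?D ph x = ?D p x - ?D e1 x" "?D nh x = ?D n x - ?D e2 x" "?D \<psi>h x = ?D \<psi> x - ?D e3 x"
      and vals: "ph x = p x - e1 x" "nh x = n x - e2 x"
      by (simp_all add: e_def)
    show ?case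
      unfolding F_def DF_def N_def D vals by (simp add: inner_diff_left algebra_simps)
  qed
  \<comment> \<open>The integrand at the discrete solution agrees almost everywhere with
    \<open>F - DF + N\<close>, so only its measurability has to be checked directly.\<close>
  have "pnp_F \<Omega> \<epsilon> (f1, f2, f3) (ph, nh, \<psi>h) v = (LINT x|?M. F x - DF x + N x)"
    unfolding v_eq pnp_F.simps Let_def
  proof (rule integral_cong_AE[OF _ _ AE])
    show "(\<lambda>x. F x - DF x + N x) \<in> borel_measurable ?M"
      using int by (intro borel_measurable_integrable ints)
  qed (intro borel_measurable_add borel_measurable_diff borel_measurable_times borel_measurable_inner
      borel_measurable_const L2s[THEN meas] uh_L2s[THEN meas])
  also have "\<dots> = (LINT x|?M. F x) - (LINT x|?M. DF x) + (LINT x|?M. N x)"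
    using int by simp
  finally show ?thesis
    unfolding v_eq pnp_F.simps pnp_DF.simps pnp_remainder_def prod.case Let_def F_def DF_def N_def .
qed

section \<open>The two-sided a posteriori error bound\<close>

theorem theorem1:
  fixes \<Omega> :: "(real ^ 2) set" and Cp C1 C2 \<sigma> \<epsilon> :: real
    and f1 f2 f3 p n \<psi> :: "real ^ 2 \<Rightarrow> real"
  assumes "bounded_lipschitz_domain \<Omega>"
    and "poincare_constant \<Omega> Cp"
    and "0 < \<epsilon>" "\<epsilon> \<le> 1"
    and "f1 \<in> L2 \<Omega>" "f2 \<in> L2 \<Omega>" "f3 \<in> L2 \<Omega>"
    and "p \<in> H1 \<Omega>" "n \<in> H1 \<Omega>" "\<psi> \<in> H1 \<Omega>"
    and weak_solution: "\<forall>v \<in> H10_3 \<Omega>. pnp_F \<Omega> \<epsilon> (f1, f2, f3) (p, n, \<psi>) v = 0"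
    and "p \<in> Linf \<Omega>" "n \<in> Linf \<Omega>" "\<psi> \<in> W1inf \<Omega>"
    and smallness: "Linf_norm \<Omega> (weak_grad \<Omega> \<psi>)
           + sqrt 2 * Cp * inverse \<epsilon> * max (Linf_norm \<Omega> p) (Linf_norm \<Omega> n)
         < sqrt 2 / (1 + Cp\<^sup>2)"
    and "C1 > 0" "C2 > 0"
    and two_sided: "\<forall>\<phi> \<in> H10_3 \<Omega>.
           \<epsilon> * C1 * dual_norm \<Omega> \<epsilon> (pnp_DF \<Omega> \<epsilon> (p, n, \<psi>) \<phi>) \<le> eps_norm3 \<Omega> \<epsilon> \<phi> \<and>
           eps_norm3 \<Omega> \<epsilon> \<phi> \<le> C2 * dual_norm \<Omega> \<epsilon> (pnp_DF \<Omega> \<epsilon> (p, n, \<psi>) \<phi>)"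
    and "\<sigma> > 0"
  shows "\<exists>\<delta>>0. \<forall>h \<T> ph nh \<psi>h e1 e2 e3.
           0 < h \<and> h < 1 \<and> quasi_uniform_triangulation \<Omega> \<sigma> h \<T> \<and>
           fe_solution \<Omega> \<epsilon> (f1, f2, f3) \<T> (p, n, \<psi>) (ph, nh, \<psi>h) \<and>
           e1 = (\<lambda>x. p x - ph x) \<and> e2 = (\<lambda>x. n x - nh x) \<and> e3 = (\<lambda>x. \<psi> x - \<psi>h x) \<and>
           e1 \<in> Linf \<Omega> \<and> e2 \<in> Linf \<Omega> \<and> max (Linf_norm \<Omega> e1) (Linf_norm \<Omega> e2) \<le> \<delta>
         \<longrightarrow>
           2 * \<epsilon> * C1 * C2 / (C1 + 2 * C2) * dual_norm \<Omega> \<epsilon> (pnp_F \<Omega> \<epsilon> (f1, f2, f3) (ph, nh, \<psi>h))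
             \<le> eps_norm3 \<Omega> \<epsilon> (e1, e2, e3) \<and>
           eps_norm3 \<Omega> \<epsilon> (e1, e2, e3)
             \<le> 2 * C2 * dual_norm \<Omega> \<epsilon> (pnp_F \<Omega> \<epsilon> (f1, f2, f3) (ph, nh, \<psi>h))"
proof -
  \<comment> \<open>Chosen so that the factor \<open>2 * \<delta> / \<epsilon>\<close> in the
    remainder bound becomes \<open>1 / (2 * C2)\<close>. It depends on neither the mesh nor the
    discrete solution.\<close>
  define \<delta> where "\<delta> = \<epsilon> / (4 * C2)"
  have "\<delta> > 0" using \<open>0 < \<epsilon>\<close> \<open>C2 > 0\<close> by (simp add: \<delta>_def)
  have "open \<Omega>" using assms(1) by (simp add: bounded_lipschitz_domain_def)
  show ?thesis
  proof (intro exI[of _ \<delta>] conjI[OF \<open>\<delta> > 0\<close>] allI impI, elim conjE)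
    fix h \<T> ph nh \<psi>h e1 e2 e3
    assume fe: "fe_solution \<Omega> \<epsilon> (f1, f2, f3) \<T> (p, n, \<psi>) (ph, nh, \<psi>h)"
      and e_def: "e1 = (\<lambda>x. p x - ph x)" "e2 = (\<lambda>x. n x - nh x)" "e3 = (\<lambda>x. \<psi> x - \<psi>h x)"
      and e_Linf: "e1 \<in> Linf \<Omega>" "e2 \<in> Linf \<Omega>"
      and small: "max (Linf_norm \<Omega> e1) (Linf_norm \<Omega> e2) \<le> \<delta>"
    let ?E = "eps_norm3 \<Omega> \<epsilon> (e1, e2, e3)"
    let ?F = "pnp_F \<Omega> \<epsilon> (f1, f2, f3) (ph, nh, \<psi>h)"
    let ?R = "pnp_DF \<Omega> \<epsilon> (p, n, \<psi>) (e1, e2, e3)"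
    let ?N = "pnp_remainder \<Omega> (e1, e2, e3)"
    have e_H10: "(e1, e2, e3) \<in> H10_3 \<Omega>"
      using fe by (simp add: e_def same_boundary_values_def)
    then have e_H1: "e1 \<in> H1 \<Omega>" "e2 \<in> H1 \<Omega>" "e3 \<in> H1 \<Omega>"
      by (auto intro: H10_imp_H1)
    have uh_H1: "ph \<in> H1 \<Omega>" "nh \<in> H1 \<Omega>" "\<psi>h \<in> H1 \<Omega>"
      using fe by simp_all
    have lower: "\<epsilon> * C1 * dual_norm \<Omega> \<epsilon> ?R \<le> ?E" and upper: "?E \<le> C2 * dual_norm \<Omega> \<epsilon> ?R"
      using two_sided e_H10 by blast+
    have "?E \<ge> 0" by (rule eps_norm3_nonneg)
    have close: "dual_norm \<Omega> \<epsilon> ?F \<le> dual_norm \<Omega> \<epsilon> ?R + ?E / (2 * C2) \<and>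
        dual_norm \<Omega> \<epsilon> ?R \<le> dual_norm \<Omega> \<epsilon> ?F + ?E / (2 * C2)"
    proof (cases "{v \<in> H10_3 \<Omega>. \<not> zero_ae \<Omega> v} = {}")
      case True
      \<comment> \<open>Then every dual norm is the same unspecified real \<open>Sup {}\<close>.\<close>
      then show ?thesis
        using \<open>?E \<ge> 0\<close> \<open>C2 > 0\<close> unfolding dual_norm_def True by simp
    next
      case False
      obtain M where M: "0 \<le> M" "\<And>v. v \<in> H10_3 \<Omega> \<Longrightarrow> \<bar>?R v\<bar> \<le> M * eps_norm3 \<Omega> \<epsilon> v"
        using pnp_DF_bounded[of \<Omega> \<epsilon> p n \<psi> e1 e2 e3] \<open>open \<Omega>\<close> assms e_H1 e_Linf by blast
      let ?K = "?E / (2 * C2)"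
      have "?K \<ge> 0" using \<open>?E \<ge> 0\<close> \<open>C2 > 0\<close> by (simp del: eps_norm3.simps)
      have K_eq: "2 * \<delta> / \<epsilon> * ?E = ?K"
        using \<open>0 < \<epsilon>\<close> by (simp add: \<delta>_def del: eps_norm3.simps)
      have N: "\<bar>?N v\<bar> \<le> ?K * eps_norm3 \<Omega> \<epsilon> v" if "v \<in> H10_3 \<Omega>" for v
        using pnp_remainder_bound[OF \<open>open \<Omega>\<close> assms(3,4) e_Linf e_H1(3) less_imp_le[OF \<open>\<delta> > 0\<close>] _ _ that] small
        unfolding K_eq by simp
      have F_eq: "?F v = - ?R v + ?N v" if "v \<in> H10_3 \<Omega>" for v
        using pnp_F_expansion[OF \<open>open \<Omega>\<close> assms(5-10,12,13) uh_H1 e_def e_H1 e_Linf that]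
          bspec[OF weak_solution that]
        by (simp del: pnp_F.simps pnp_DF.simps)
      have F_le: "\<bar>?F v\<bar> \<le> \<bar>?R v\<bar> + ?K * eps_norm3 \<Omega> \<epsilon> v"
        and R_le: "\<bar>?R v\<bar> \<le> \<bar>?F v\<bar> + ?K * eps_norm3 \<Omega> \<epsilon> v" if "v \<in> H10_3 \<Omega>" for v
        using N[OF that] F_eq[OF that] by linarith+
      \<comment> \<open>The perturbation lemma is also used with the two functionals exchanged,
        which requires the supremum for \<open>?F\<close> to be bounded as well.\<close>
      have F_bounded: "\<bar>?F v\<bar> \<le> (M + ?K) * eps_norm3 \<Omega> \<epsilon> v" if "v \<in> H10_3 \<Omega>" for v
        using F_le[OF that] M(2)[OF that] unfolding distrib_right by linarith
      show ?thesis
        using dual_norm_perturbation[OF False M \<open>?K \<ge> 0\<close> F_le]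
          dual_norm_perturbation[OF False _ F_bounded \<open>?K \<ge> 0\<close> R_le] M(1) \<open>?K \<ge> 0\<close>
        by linarith
    qed
    \<comment> \<open>The perturbation contributes exactly half of \<open>?E\<close>, which is
      absorbed into the left-hand side; this is where the factor 2 in the upper bound
      arises.\<close>
    have "?E \<le> C2 * (dual_norm \<Omega> \<epsilon> ?F + ?E / (2 * C2))"
      using upper close \<open>C2 > 0\<close> by (meson mult_left_mono order_trans less_imp_le)
    also have "\<dots> = C2 * dual_norm \<Omega> \<epsilon> ?F + ?E / 2"
      using \<open>C2 > 0\<close> by (simp add: field_simps del: eps_norm3.simps)
    finally have upper': "?E \<le> 2 * C2 * dual_norm \<Omega> \<epsilon> ?F" by linarith
    have "2 * \<epsilon> * C1 * C2 * dual_norm \<Omega> \<epsilon> ?F \<le> 2 * \<epsilon> * C1 * C2 * (dual_norm \<Omega> \<epsilon> ?R + ?E / (2 * C2))"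
      using close \<open>C1 > 0\<close> \<open>C2 > 0\<close> \<open>0 < \<epsilon>\<close> by (intro mult_left_mono) auto
    also have "\<dots> = 2 * C2 * (\<epsilon> * C1 * dual_norm \<Omega> \<epsilon> ?R) + \<epsilon> * (C1 * ?E)"
      using \<open>C2 > 0\<close> by (simp add: field_simps del: eps_norm3.simps)
    \<comment> \<open>The first term uses the lower estimate for the residual, the second
      \<open>\<epsilon> \<le> 1\<close>. The sum is \<open>(C1 + 2 * C2) * ?E\<close>, whence the
      denominator of the constant.\<close>
    also have "\<dots> \<le> 2 * C2 * ?E + 1 * (C1 * ?E)"
      using lower \<open>C1 > 0\<close> \<open>C2 > 0\<close> \<open>\<epsilon> \<le> 1\<close> \<open>?E \<ge> 0\<close>
      by (intro add_mono mult_left_mono mult_right_mono mult_nonneg_nonneg) simp_all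
    finally have lower': "2 * \<epsilon> * C1 * C2 / (C1 + 2 * C2) * dual_norm \<Omega> \<epsilon> ?F \<le> ?E"
      using \<open>C1 > 0\<close> \<open>C2 > 0\<close> by (simp add: field_simps del: eps_norm3.simps)
    from lower' upper' show "2 * \<epsilon> * C1 * C2 / (C1 + 2 * C2) * dual_norm \<Omega> \<epsilon> ?F \<le> ?E \<and>
        ?E \<le> 2 * C2 * dual_norm \<Omega> \<epsilon> ?F" ..
  qed
qed

end
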